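(* The bold homology $\mathbb{H}$ is a categorification of the evaluation at $-1$ of the connected domination polynomial. That is: (a) for every commutative ring $R$, the bold homology $G\mapsto \mathbb{H}_*(G;R)$ is functorial with respect to injective morphisms of (finite, simple, connected) graphs; (b) for every finite, simple, connected graph $G$ (with coefficients in a field), the Euler characteristic $\chi(\mathbb{H}(G))=\sum_i(-1)^i\operatorname{rank}\mathbb{H}_i(G)$ equals $D^c_G(-1)$, where $D^c_G(x)$ is the connected domination polynomial of $G$.
   Context: Graphs are finite, simple and connected. An injective morphism of graphs is a map of vertex sets that is injective and sends edges to edges (an injective simplicial map of $1$-dimensional complexes). Bold homology. Let $G$ be a graph and $R$ a commutative ring; order $V(G)$. A bi-colouring is a map $\varepsilon\colon V(G)\to\{0,1\}$, and $G_\varepsilon$ denotes the subgraph of $G$ induced by the vertices $v$ with $\varepsilon(v)=1$. Write $\varepsilon\,\widetilde{\triangleleft}\,\varepsilon'$ if $\varepsilon'$ is obtained from $\varepsilon$ by changing the value at exactly one vertex from $0$ to $1$. A sign assignment is a choice of $s(\varepsilon,\varepsilon')\in\mathbb{Z}/2$ for each such pair with $s(\varepsilon,\varepsilon_1)+s(\varepsilon_1,\varepsilon'')\equiv s(\varepsilon,\varepsilon_2)+s(\varepsilon_2,\varepsilon'')+1\pmod 2$ whenever $\varepsilon\,\widetilde{\triangleleft}\,\varepsilon_1,\varepsilon_2\,\widetilde{\triangleleft}\,\varepsilon''$, $\varepsilon_1\neq\varepsilon_2$; it exists and the choice does not affect the complex up to isomorphism. The bold chain group is \[\mathrm{C}\mathbb{H}_i(G;R)=\bigoplus_{\varepsilon:\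 \sum_v\varepsilon(v)=i}\ \bigoplus_{x\in\pi_0(G_\varepsilon)}R\langle x\rangle,\] where $\pi_0$ is the set of connected components (so $\mathrm{C}\mathbb{H}_0=0$), with differential $d^i\colon \mathrm{C}\mathbb{H}_i\to\mathrm{C}\mathbb{H}_{i+1}$ given for $x\in\pi_0(G_\varepsilon)$ by $d^i(x)=\sum(-1)^{s(\varepsilon,\varepsilon')}y$, the sum over all $\varepsilon'$ with $\varepsilon\,\widetilde{\triangleleft}\,\varepsilon'$ and the component $y\in\pi_0(G_{\varepsilon'})$ with $V(x)\subseteq V(y)$. Its homology is the bold homology $\mathbb{H}_*(G;R)$. Connected domination polynomial. A subset $D\subseteq V(G)$ is dominating if every vertex of $V(G)\setminus D$ is adjacent to some member of $D$; it is a connected dominating set if moreover its induced subgraph is connected. $D^c_G(x)=\sum_k d^c_G(k)x^k$, where $d^c_G(k)$ is the number of connected dominating sets of $G$ with exactly $k$ vertices. *)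

theory Defs
  imports
    "Graph_Theory.Graph_Theory"
    "Jordan_Normal_Form.Missing_VectorSpace"
    "HOL-Algebra.AbelCoset"
    "HOL-Computational_Algebra.Polynomial"
    "HOL-Library.Z2"
begin

section \<open>Graphs\<close>

text \<open>A simple graph is a symmetric loop-free digraph without parallel arcs (\<^locale>\<open>pair_graph\<close>, which
  includes finiteness). Connectedness in the sense of the library excludes the null graph.\<close>

definition fin_conn_graph :: "'a pair_pre_digraph \<Rightarrow> bool" where
  "fin_conn_graph G \<longleftrightarrow> pair_graph G \<and> Digraph_Component.connected (with_proj G)"

definition inj_morphism :: "'a pair_pre_digraph \<Rightarrow> 'b pair_pre_digraph \<Rightarrow> ('a \<Rightarrow> 'b) \<Rightarrow> bool" where
  "inj_morphism G H f \<longleftrightarrow> f ` pverts G \<subseteq> pverts H \<and> inj_on f (pverts G) \<and>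
     (\<forall>(u, v) \<in> parcs G. (f u, f v) \<in> parcs H)"

text \<open>A component is represented by its vertex set. For a symmetric digraph the strongly connected
  components are the connected components.\<close>

definition components :: "'a pair_pre_digraph \<Rightarrow> 'a set \<Rightarrow> 'a set set" where
  "components G S = pre_digraph.sccs_verts (with_proj G \<restriction> S)"


section \<open>Modules\<close>

definition quotient_module :: "('r, 'a, 'm) module_scheme \<Rightarrow> 'a set \<Rightarrow> ('r, 'a set) module" where
  "quotient_module M N =
     \<lparr> carrier = a_rcosets\<^bsub>M\<^esub> N,
       mult = (\<lambda>X Y. N),
       one = N,
       zero = N,
       add = (\<lambda>X Y. X <+>\<^bsub>M\<^esub> Y),
       module.smult = (\<lambda>r X. \<Union>x\<in>X. N +>\<^bsub>M\<^esub> (r \<odot>\<^bsub>M\<^esub> x)) \<rparr>"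

text \<open>The free module on a finite set \<open>A\<close> is \<open>ring.func_space R A\<close>, the functions \<open>A \<rightarrow> R\<close>.\<close>

definition generator :: "('r, 'm) ring_scheme \<Rightarrow> 'a set \<Rightarrow> 'a \<Rightarrow> 'a \<Rightarrow> 'r" where
  "generator R A a = (\<lambda>b\<in>A. if b = a then \<one>\<^bsub>R\<^esub> else \<zero>\<^bsub>R\<^esub>)"

definition linear_extension ::
    "'a set \<Rightarrow> ('r, 'b, 'm) module_scheme \<Rightarrow> ('a \<Rightarrow> 'b) \<Rightarrow> ('a \<Rightarrow> 'r) \<Rightarrow> 'b" where
  "linear_extension A M \<phi> c = finsum M (\<lambda>a. c a \<odot>\<^bsub>M\<^esub> \<phi> a) A"

definition sign :: "('r, 'm) ring_scheme \<Rightarrow> bit \<Rightarrow> 'r" where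
  "sign R b = (if b = 0 then \<one>\<^bsub>R\<^esub> else \<ominus>\<^bsub>R\<^esub> \<one>\<^bsub>R\<^esub>)"


section \<open>Bold homology\<close>

text \<open>A bi-colouring of \<open>G\<close> is identified with the set \<open>S \<subseteq> pverts G\<close> of vertices of colour \<open>1\<close>.\<close>

definition flip :: "'a pair_pre_digraph \<Rightarrow> 'a set \<Rightarrow> 'a set \<Rightarrow> bool" where
  "flip G S T \<longleftrightarrow> S \<subseteq> pverts G \<and> (\<exists>v \<in> pverts G - S. T = insert v S)"

definition sign_assignment :: "'a pair_pre_digraph \<Rightarrow> ('a set \<Rightarrow> 'a set \<Rightarrow> bit) \<Rightarrow> bool" where
  "sign_assignment G s \<longleftrightarrow>
     (\<forall>S S\<^sub>1 S\<^sub>2 T. flip G S S\<^sub>1 \<and> flip G S\<^sub>1 T \<and> flip G S S\<^sub>2 \<and> flip G S\<^sub>2 T \<and> S\<^sub>1 \<noteq> S\<^sub>2 \<longrightarrow>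
        s S S\<^sub>1 + s S\<^sub>1 T = s S S\<^sub>2 + s S\<^sub>2 T + 1)"

definition bold_gens :: "'a pair_pre_digraph \<Rightarrow> nat \<Rightarrow> ('a set \<times> 'a set) set" where
  "bold_gens G i = {(S, x). S \<subseteq> pverts G \<and> card S = i \<and> x \<in> components G S}"

definition bold_chain ::
    "('r, 'm) ring_scheme \<Rightarrow> 'a pair_pre_digraph \<Rightarrow> nat \<Rightarrow> ('r, 'a set \<times> 'a set \<Rightarrow> 'r) module" where
  "bold_chain R G i = ring.func_space R (bold_gens G i)"

definition bold_diff_gen ::
    "('r, 'm) ring_scheme \<Rightarrow> 'a pair_pre_digraph \<Rightarrow> ('a set \<Rightarrow> 'a set \<Rightarrow> bit) \<Rightarrow> nat \<Rightarrow>
     'a set \<times> 'a set \<Rightarrow> 'a set \<times> 'a set \<Rightarrow> 'r" where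
  "bold_diff_gen R G s i = (\<lambda>(S, x).
     finsum (bold_chain R G (Suc i))
       (\<lambda>(T, y). sign R (s S T) \<odot>\<^bsub>bold_chain R G (Suc i)\<^esub> generator R (bold_gens G (Suc i)) (T, y))
       {(T, y). flip G S T \<and> y \<in> components G T \<and> x \<subseteq> y})"

definition bold_diff ::
    "('r, 'm) ring_scheme \<Rightarrow> 'a pair_pre_digraph \<Rightarrow> ('a set \<Rightarrow> 'a set \<Rightarrow> bit) \<Rightarrow> nat \<Rightarrow>
     ('a set \<times> 'a set \<Rightarrow> 'r) \<Rightarrow> 'a set \<times> 'a set \<Rightarrow> 'r" where
  "bold_diff R G s i =
     linear_extension (bold_gens G i) (bold_chain R G (Suc i)) (bold_diff_gen R G s i)"

definition bold_cycles ::
    "('r, 'm) ring_scheme \<Rightarrow> 'a pair_pre_digraph \<Rightarrow> ('a set \<Rightarrow> 'a set \<Rightarrow> bit) \<Rightarrow> nat \<Rightarrow>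
     ('a set \<times> 'a set \<Rightarrow> 'r) set" where
  "bold_cycles R G s i =
     mod_hom.ker (bold_chain R G i) (bold_chain R G (Suc i)) (bold_diff R G s i)"

fun bold_boundaries ::
    "('r, 'm) ring_scheme \<Rightarrow> 'a pair_pre_digraph \<Rightarrow> ('a set \<Rightarrow> 'a set \<Rightarrow> bit) \<Rightarrow> nat \<Rightarrow>
     ('a set \<times> 'a set \<Rightarrow> 'r) set" where
  "bold_boundaries R G s 0 = {\<zero>\<^bsub>bold_chain R G 0\<^esub>}"
| "bold_boundaries R G s (Suc i) = mod_hom.im (bold_chain R G i) (bold_diff R G s i)"

definition bold_homology ::
    "('r, 'm) ring_scheme \<Rightarrow> 'a pair_pre_digraph \<Rightarrow> ('a set \<Rightarrow> 'a set \<Rightarrow> bit) \<Rightarrow> nat \<Rightarrow>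
     ('r, ('a set \<times> 'a set \<Rightarrow> 'r) set) module" where
  "bold_homology R G s i =
     quotient_module ((bold_chain R G i)\<lparr>carrier := bold_cycles R G s i\<rparr>) (bold_boundaries R G s i)"

text \<open>Chain groups vanish in degrees above \<open>card (pverts G)\<close>, so the sum below is the full
  alternating sum.\<close>

definition bold_euler ::
    "('r, 'm) ring_scheme \<Rightarrow> 'a pair_pre_digraph \<Rightarrow> ('a set \<Rightarrow> 'a set \<Rightarrow> bit) \<Rightarrow> int" where
  "bold_euler K G s =
     (\<Sum>i\<le>card (pverts G). (-1) ^ i * int (vectorspace.dim K (bold_homology K G s i)))"


section \<open>Maps induced by injective morphisms\<close>

text \<open>An injective morphism \<open>f\<close> from \<open>G\<close> to \<open>H\<close> turns a bi-colouring \<open>S\<close> of \<open>G\<close> into a bi-colouring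
  of \<open>H\<close> by giving colour \<open>1\<close> to every vertex outside the image of \<open>f\<close>. (With colour \<open>0\<close> instead the
  resulting map does not commute with the differentials: the differential of \<open>H\<close> also flips the
  vertices outside the image.) Hence \<open>f\<close> acts by a map that is homogeneous of degree
  \<open>card (pverts H) - card (pverts G)\<close>, i.e. it preserves the number of vertices of colour \<open>0\<close>.\<close>

definition extend_colouring ::
    "'a pair_pre_digraph \<Rightarrow> 'b pair_pre_digraph \<Rightarrow> ('a \<Rightarrow> 'b) \<Rightarrow> 'a set \<Rightarrow> 'b set" where
  "extend_colouring G H f S = f ` S \<union> (pverts H - f ` pverts G)"

definition degree_shift :: "'a pair_pre_digraph \<Rightarrow> 'b pair_pre_digraph \<Rightarrow> nat" where
  "degree_shift G H = card (pverts H) - card (pverts G)"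

text \<open>The sign assignments of \<open>G\<close> and \<open>H\<close> are unrelated, so the induced chain map needs a correction
  sign in front of each generator. Commutation with the differentials determines these signs up to one
  global sign, which is fixed by requiring the sign to be trivial on the constant bi-colouring \<open>1\<close>.
  This normalisation is compatible with composition.\<close>

definition correction_sign ::
    "'a pair_pre_digraph \<Rightarrow> ('a set \<Rightarrow> 'a set \<Rightarrow> bit) \<Rightarrow>
     'b pair_pre_digraph \<Rightarrow> ('b set \<Rightarrow> 'b set \<Rightarrow> bit) \<Rightarrow> ('a \<Rightarrow> 'b) \<Rightarrow> 'a set \<Rightarrow> bit" where
  "correction_sign G s H t f =
     (THE \<sigma>. \<sigma> \<in> extensional (Pow (pverts G)) \<and> \<sigma> (pverts G) = 0 \<and>
        (\<forall>S T. flip G S T \<longrightarrow>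
           s S T + \<sigma> T = \<sigma> S + t (extend_colouring G H f S) (extend_colouring G H f T)))"

definition bold_chain_map ::
    "('r, 'm) ring_scheme \<Rightarrow> 'a pair_pre_digraph \<Rightarrow> ('a set \<Rightarrow> 'a set \<Rightarrow> bit) \<Rightarrow>
     'b pair_pre_digraph \<Rightarrow> ('b set \<Rightarrow> 'b set \<Rightarrow> bit) \<Rightarrow> ('a \<Rightarrow> 'b) \<Rightarrow> nat \<Rightarrow>
     ('a set \<times> 'a set \<Rightarrow> 'r) \<Rightarrow> 'b set \<times> 'b set \<Rightarrow> 'r" where
  "bold_chain_map R G s H t f i =
     (let j = i + degree_shift G H; C = bold_chain R H j in
      linear_extension (bold_gens G i) C
        (\<lambda>(S, x). let T = extend_colouring G H f S in
           sign R (correction_sign G s H t f S) \<odot>\<^bsub>C\<^esub>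
             generator R (bold_gens H j) (T, THE y. y \<in> components H T \<and> f ` x \<subseteq> y)))"

text \<open>The union below is a single coset exactly when the chain map is well defined on the class \<open>X\<close>.\<close>

definition bold_map ::
    "('r, 'm) ring_scheme \<Rightarrow> 'a pair_pre_digraph \<Rightarrow> ('a set \<Rightarrow> 'a set \<Rightarrow> bit) \<Rightarrow>
     'b pair_pre_digraph \<Rightarrow> ('b set \<Rightarrow> 'b set \<Rightarrow> bit) \<Rightarrow> ('a \<Rightarrow> 'b) \<Rightarrow> nat \<Rightarrow>
     ('a set \<times> 'a set \<Rightarrow> 'r) set \<Rightarrow> ('b set \<times> 'b set \<Rightarrow> 'r) set" where
  "bold_map R G s H t f i X =
     (let j = i + degree_shift G H in
      \<Union>z\<in>X. bold_boundaries R H t j +>\<^bsub>bold_chain R H j\<^esub> bold_chain_map R G s H t f i z)"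


section \<open>Connected domination\<close>

definition dominating :: "'a pair_pre_digraph \<Rightarrow> 'a set \<Rightarrow> bool" where
  "dominating G D \<longleftrightarrow> D \<subseteq> pverts G \<and> (\<forall>v \<in> pverts G - D. \<exists>u \<in> D. (v, u) \<in> parcs G)"

definition connected_dominating :: "'a pair_pre_digraph \<Rightarrow> 'a set \<Rightarrow> bool" where
  "connected_dominating G D \<longleftrightarrow>
     dominating G D \<and> Digraph_Component.connected (with_proj G \<restriction> D)"

definition conn_dom_poly :: "'a pair_pre_digraph \<Rightarrow> int poly" where
  "conn_dom_poly G =
     (\<Sum>k\<le>card (pverts G). monom (int (card {D. connected_dominating G D \<and> card D = k})) k)"


section \<open>Sign assignments exist\<close>

lemma bit_of_nat_Suc: "(of_nat (Suc n) :: bit) = of_nat n + 1"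
  by simp

lemma sign_assignment_exists:
  assumes "finite (pverts G)"
  shows "\<exists>s. sign_assignment G s"
proof -
  obtain h :: "'a \<Rightarrow> nat" where h: "inj_on h (pverts G)"
    using finite_imp_inj_to_nat_seg[OF assms] by blast
  define s :: "'a set \<Rightarrow> 'a set \<Rightarrow> bit"
    where "s S T = of_nat (card {u \<in> S. \<exists>v \<in> T - S. h u < h v})" for S T
  have s_ins: "s S (insert v S) = of_nat (card {u \<in> S. h u < h v})" if "v \<notin> S" for S v
  proof -
    have "insert v S - S = {v}" using that by auto
    then show ?thesis by (simp add: s_def)
  qed
  have *: "s S (insert v S) + s (insert v S) (insert w (insert v S)) =
        s S (insert w S) + s (insert w S) (insert v (insert w S)) + 1"
    if S: "S \<subseteq> pverts G" and v: "v \<in> pverts G" "v \<notin> S" and w: "w \<in> pverts G" "w \<notin> S" and lt: "h v < h w"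
    for S v w
  proof -
    have fin: "finite S" using S assms by (rule finite_subset)
    have "{u \<in> insert v S. h u < h w} = insert v {u \<in> S. h u < h w}" using lt by auto
    then have 1: "card {u \<in> insert v S. h u < h w} = Suc (card {u \<in> S. h u < h w})"
      using fin v by simp
    have 2: "{u \<in> insert w S. h u < h v} = {u \<in> S. h u < h v}" using lt by auto
    have "v \<noteq> w" using lt by auto
    then have 3: "w \<notin> insert v S" "v \<notin> insert w S" using v w by auto
    show ?thesis
      unfolding s_ins[OF 3(1)] s_ins[OF 3(2)] 1 2 s_ins[OF v(2)] s_ins[OF w(2)] bit_of_nat_Suc
      by (simp only: ac_simps)
  qed
  have "sign_assignment G s"
    unfolding sign_assignment_def
  proof (intro allI impI, elim conjE)
    fix S S1 S2 T
    assume f: "flip G S S1" "flip G S1 T" "flip G S S2" "flip G S2 T" and ne: "S1 \<noteq> S2"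
    from f obtain v w where vw: "S \<subseteq> pverts G" "v \<in> pverts G" "v \<notin> S" "S1 = insert v S"
      "w \<in> pverts G" "w \<notin> S" "S2 = insert w S" unfolding flip_def by blast
    from ne vw have "v \<noteq> w" by auto
    moreover from f obtain a b where "T = insert a S1" "a \<notin> S1" "T = insert b S2" "b \<notin> S2"
      unfolding flip_def by blast
    ultimately have T: "T = insert w S1" "T = insert v S2" using vw by auto
    from \<open>v \<noteq> w\<close> h vw have "h v \<noteq> h w" by (meson inj_onD)
    then consider "h v < h w" | "h w < h v" by linarith
    then show "s S S1 + s S1 T = s S S2 + s S2 T + 1"
    proof cases
      case 1
      from *[OF vw(1-3) vw(5,6) 1] show ?thesis using T vw by metis
    next
      case 2
      from *[OF vw(1) vw(5,6) vw(2,3) 2]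
      have "s S S2 + s S2 T = s S S1 + s S1 T + 1" using T vw by metis
      then show ?thesis by (simp add: add.assoc)
    qed
  qed
  then show ?thesis by blast
qed

end

theory Submission
  imports Defs
begin

text \<open>
  Why the theorem holds.

  Euler characteristic. Taking homology does not change the alternating sum of dimensions
  (\<open>euler_poincare\<close>, from rank-nullity), so the Euler characteristic is the signed number of pairs
  \<open>(S, x)\<close> with \<open>x\<close> a component of the subgraph induced by \<open>S\<close>. Now exchange the order of summation
  and fix \<open>x\<close>: it is a connected set, and it is a component of \<open>S\<close> exactly when \<open>S\<close> arises from \<open>x\<close> by
  adding vertices that are neither in \<open>x\<close> nor adjacent to it. If there are any such vertices, the signs
  \<open>(-1) ^ card S\<close> cancel; if there are none, \<open>x\<close> is dominating and \<open>S = x\<close> is the only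
  choice. What remains is the signed number of connected dominating sets (\<open>euler_bold_gens\<close>).

  Functoriality. The components form a functor from the cube of vertex sets: for \<open>S \<subseteq> T\<close>,
  a component of \<open>S\<close> goes to the unique component of \<open>T\<close> above it. The differential is the signed sum
  of these maps over the edges of the cube, and it squares to zero because the two ways around a square
  of the cube agree up to a sign (\<open>diff_diff\<close>). An injective morphism \<open>f\<close> embeds the cube of \<open>G\<close> into
  that of \<open>H\<close> as the face of the sets containing all vertices outside the image of \<open>f\<close>. Along this
  face, the two sign assignments differ by a cocycle with values in the integers mod 2. The cube is
  contractible, so the cocycle is the coboundary of a function of the vertex set that is unique once its
  value at the top is fixed (\<open>cube_cocycle_is_coboundary\<close>, \<open>cube_potential_unique\<close>). Twisting by this
  function gives a chain map. Uniqueness shows that the twists compose as the morphisms do: the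
  twist of a composite and the sum of the two twists solve the same equations. Everything else is checked on
  generators of free modules and passed to cosets.
\<close>

section \<open>Free modules\<close>

lemma (in cring) func_space_carrier: "carrier (func_space A) = A \<rightarrow>\<^sub>E carrier R"
  by (simp add: func_space_def)

lemma (in cring) func_space_zero: "\<zero>\<^bsub>func_space A\<^esub> = (\<lambda>a\<in>A. \<zero>)"
  by (simp add: func_space_def)

lemma (in cring) func_space_add: "f \<oplus>\<^bsub>func_space A\<^esub> g = (\<lambda>a\<in>A. f a \<oplus> g a)"
  by (simp add: func_space_def)

lemma (in cring) func_space_smult: "r \<odot>\<^bsub>func_space A\<^esub> f = (\<lambda>a\<in>A. r \<otimes> f a)"
  by (simp add: func_space_def)

lemma (in cring) generator_closed [simp]: "generator R A a \<in> carrier (func_space A)"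
  by (auto simp: func_space_carrier generator_def)

lemma (in cring) func_space_finsum:
  assumes "finite I" "F \<in> I \<rightarrow> carrier (func_space A)"
  shows "finsum (func_space A) F I = (\<lambda>a\<in>A. finsum R (\<lambda>i. F i a) I)"
  using assms
proof (induction I)
  case empty
  interpret M: module R "func_space A" by (rule func_space_is_module)
  show ?case by (simp add: func_space_zero)
next
  case (insert i I)
  interpret M: module R "func_space A" by (rule func_space_is_module)
  from insert.prems have F: "F i \<in> A \<rightarrow>\<^sub>E carrier R" "\<And>j. j \<in> I \<Longrightarrow> F j \<in> A \<rightarrow>\<^sub>E carrier R"
    by (auto simp: func_space_carrier)
  have "finsum (func_space A) F (insert i I) = F i \<oplus>\<^bsub>func_space A\<^esub> finsum (func_space A) F I"
    using insert by (intro M.finsum_insert) auto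
  also have "\<dots> = (\<lambda>a\<in>A. F i a \<oplus> finsum R (\<lambda>i. F i a) I)"
    using insert by (auto simp: func_space_add fun_eq_iff)
  also have "\<dots> = (\<lambda>a\<in>A. finsum R (\<lambda>i. F i a) (insert i I))"
  proof (rule restrict_ext)
    fix a assume a: "a \<in> A"
    show "F i a \<oplus> finsum R (\<lambda>i. F i a) I = finsum R (\<lambda>i. F i a) (insert i I)"
      using insert.hyps F a by (subst finsum_insert) (auto simp: PiE_iff)
  qed
  finally show ?case .
qed

text \<open>Evaluated at a basis element, the sum has a single nonzero term.\<close>

lemma (in cring) generator_expansion:
  assumes "finite A" and c: "c \<in> carrier (func_space A)"
  shows "linear_extension A (func_space A) (generator R A) c = c"
proof -
  interpret M: module R "func_space A" by (rule func_space_is_module)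
  have cR: "c a \<in> carrier R" if "a \<in> A" for a using c that by (auto simp: func_space_carrier PiE_iff)
  have "linear_extension A (func_space A) (generator R A) c =
      (\<lambda>b\<in>A. finsum R (\<lambda>a. (c a \<odot>\<^bsub>func_space A\<^esub> generator R A a) b) A)"
    unfolding linear_extension_def using assms cR by (intro func_space_finsum) auto
  also have "\<dots> = (\<lambda>b\<in>A. c b)"
  proof (rule restrict_ext)
    fix b assume b: "b \<in> A"
    have "finsum R (\<lambda>a. (c a \<odot>\<^bsub>func_space A\<^esub> generator R A a) b) A =
        finsum R (\<lambda>a. if b = a then c a else \<zero>) A"
      using b cR by (intro finsum_cong') (auto simp: func_space_smult generator_def)
    also have "\<dots> = c b" using b cR assms by (intro finsum_singleton) auto
    finally show "finsum R (\<lambda>a. (c a \<odot>\<^bsub>func_space A\<^esub> generator R A a) b) A = c b" .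
  qed
  also have "\<dots> = c" using c by (auto simp: func_space_carrier extensional_restrict PiE_def)
  finally show ?thesis .
qed

lemma (in module) linear_extension_hom:
  assumes "finite A" and \<phi>: "\<phi> \<in> A \<rightarrow> carrier M"
  shows "mod_hom R (R.func_space A) M (linear_extension A M \<phi>)"
proof -
  interpret F: module R "R.func_space A" by (rule R.func_space_is_module)
  have cl: "c a \<in> carrier R" if "c \<in> carrier (R.func_space A)" "a \<in> A" for c a
    using that by (auto simp: R.func_space_carrier PiE_iff)
  have ph: "\<phi> a \<in> carrier M" if "a \<in> A" for a using \<phi> that by auto
  have "linear_extension A M \<phi> \<in> module_hom R (R.func_space A) M"
    unfolding module_hom_def linear_extension_def
  proof (safe)
    fix c assume "c \<in> carrier (R.func_space A)"
    then show "(\<Oplus>\<^bsub>M\<^esub>a\<in>A. c a \<odot>\<^bsub>M\<^esub> \<phi> a) \<in> carrier M"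
      by (intro M.finsum_closed) (auto intro: cl ph)
  next
    fix c d assume cd: "c \<in> carrier (R.func_space A)" "d \<in> carrier (R.func_space A)"
    have "(\<Oplus>\<^bsub>M\<^esub>a\<in>A. (c \<oplus>\<^bsub>R.func_space A\<^esub> d) a \<odot>\<^bsub>M\<^esub> \<phi> a) =
        (\<Oplus>\<^bsub>M\<^esub>a\<in>A. c a \<odot>\<^bsub>M\<^esub> \<phi> a \<oplus>\<^bsub>M\<^esub> d a \<odot>\<^bsub>M\<^esub> \<phi> a)"
      using cd by (intro M.finsum_cong') (auto simp: R.func_space_add smult_l_distr cl ph)
    also have "\<dots> = (\<Oplus>\<^bsub>M\<^esub>a\<in>A. c a \<odot>\<^bsub>M\<^esub> \<phi> a) \<oplus>\<^bsub>M\<^esub> (\<Oplus>\<^bsub>M\<^esub>a\<in>A. d a \<odot>\<^bsub>M\<^esub> \<phi> a)"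
      using cd by (intro M.finsum_addf) (auto intro: cl ph)
    finally show "(\<Oplus>\<^bsub>M\<^esub>a\<in>A. (c \<oplus>\<^bsub>R.func_space A\<^esub> d) a \<odot>\<^bsub>M\<^esub> \<phi> a) = \<dots>" .
  next
    fix r c assume rc: "r \<in> carrier R" "c \<in> carrier (R.func_space A)"
    have "(\<Oplus>\<^bsub>M\<^esub>a\<in>A. (r \<odot>\<^bsub>R.func_space A\<^esub> c) a \<odot>\<^bsub>M\<^esub> \<phi> a) =
        (\<Oplus>\<^bsub>M\<^esub>a\<in>A. r \<odot>\<^bsub>M\<^esub> (c a \<odot>\<^bsub>M\<^esub> \<phi> a))"
      using rc by (intro M.finsum_cong') (auto simp: R.func_space_smult smult_assoc1 cl ph)
    also have "\<dots> = r \<odot>\<^bsub>M\<^esub> (\<Oplus>\<^bsub>M\<^esub>a\<in>A. c a \<odot>\<^bsub>M\<^esub> \<phi> a)"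
      using rc by (intro finsum_smult [symmetric]) (auto intro: cl ph)
    finally show "(\<Oplus>\<^bsub>M\<^esub>a\<in>A. (r \<odot>\<^bsub>R.func_space A\<^esub> c) a \<odot>\<^bsub>M\<^esub> \<phi> a) = \<dots>" .
  qed
  then show ?thesis
    by (intro mod_hom.intro mod_hom_axioms.intro F.module_axioms module_axioms)
qed

lemma (in module) linear_extension_generator:
  assumes "finite A" and \<phi>: "\<phi> \<in> A \<rightarrow> carrier M" and a: "a \<in> A"
  shows "linear_extension A M \<phi> (generator R A a) = \<phi> a"
proof -
  have ph: "\<phi> b \<in> carrier M" if "b \<in> A" for b using \<phi> that by auto
  have "linear_extension A M \<phi> (generator R A a) = finsum M (\<lambda>b. if a = b then \<phi> b else \<zero>\<^bsub>M\<^esub>) A"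
    unfolding linear_extension_def
    by (intro M.finsum_cong') (auto simp: generator_def ph)
  also have "\<dots> = \<phi> a" using assms by (intro M.finsum_singleton) auto
  finally show ?thesis .
qed

lemma (in mod_hom) hom_finsum:
  assumes "g \<in> A \<rightarrow> carrier M"
  shows "f (finsum M g A) = finsum N (\<lambda>a. f (g a)) A"
  using assms
proof (induction A rule: infinite_finite_induct)
  case (insert a A)
  then have "finsum M g (insert a A) = g a \<oplus>\<^bsub>M\<^esub> finsum M g A" "finsum M g A \<in> carrier M" "g a \<in> carrier M"
    by (auto intro!: M.finsum_insert)
  moreover have "finsum N (\<lambda>a. f (g a)) (insert a A) = f (g a) \<oplus>\<^bsub>N\<^esub> finsum N (\<lambda>a. f (g a)) A"
    using insert by (intro N.M.finsum_insert) auto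
  ultimately show ?case using insert by auto
qed auto

lemma (in mod_hom) hom_linear_extension:
  assumes "\<phi> \<in> A \<rightarrow> carrier M" "c \<in> A \<rightarrow> carrier R"
  shows "f (linear_extension A M \<phi> c) = linear_extension A N (f \<circ> \<phi>) c"
proof -
  have ph: "\<phi> b \<in> carrier M" if "b \<in> A" for b using assms that by auto
  have ch: "c b \<in> carrier R" if "b \<in> A" for b using assms that by auto
  show ?thesis unfolding linear_extension_def
    by (subst hom_finsum) (auto intro!: N.M.finsum_cong' simp: ph ch)
qed

text \<open>A linear map out of a free module is determined by the generators, because every
  coefficient function is the linear extension of the generators by itself. All identities between
  differentials and chain maps are reduced to generators in this way.\<close>

lemma func_space_hom_ext:
  assumes f: "mod_hom R (ring.func_space R A) N f" and g: "mod_hom R (ring.func_space R A) N g"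
    and A: "finite A"
    and eq: "\<And>a. a \<in> A \<Longrightarrow> f (generator R A a) = g (generator R A a)"
    and c: "c \<in> carrier (ring.func_space R A)"
  shows "f c = g c"
proof -
  interpret f: mod_hom R "ring.func_space R A" N f by fact
  interpret g: mod_hom R "ring.func_space R A" N g by fact
  have c': "c \<in> A \<rightarrow> carrier R" using c by (auto simp: f.R.func_space_carrier PiE_iff)
  have gen: "generator R A \<in> A \<rightarrow> carrier (ring.func_space R A)"
    by (auto intro: f.R.generator_closed)
  have "f c = linear_extension A N (f \<circ> generator R A) c"
    by (subst f.R.generator_expansion [OF A c, symmetric]) (rule f.hom_linear_extension [OF gen c'])
  also have "\<dots> = linear_extension A N (g \<circ> generator R A) c"
    unfolding linear_extension_def
    by (rule f.N.M.finsum_cong') (use eq c' gen in auto)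
  also have "\<dots> = g c"
    by (subst (2) f.R.generator_expansion [OF A c, symmetric]) (rule g.hom_linear_extension [OF gen c', symmetric])
  finally show ?thesis .
qed

lemma mod_hom_comp:
  assumes "mod_hom R M N f" "mod_hom R N P g"
  shows "mod_hom R M P (g \<circ> f)"
proof -
  interpret f: mod_hom R M N f by fact
  interpret g: mod_hom R N P g by fact
  show ?thesis
    by (intro mod_hom.intro mod_hom_axioms.intro f.M.module_axioms g.N.module_axioms)
       (auto simp: module_hom_def)
qed

section \<open>Quotient modules\<close>

lemma (in module) submodule_abelian_subgroup:
  assumes N: "submodule R N M"
  shows "abelian_subgroup N M"
proof -
  interpret N: submodule R N M by fact
  have "subgroup N (add_monoid M)"
  proof (intro group.subgroupI M.a_group)
    show "N \<subseteq> carrier (add_monoid M)" using N.subset by simp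
    show "N \<noteq> {}" using N.zero_closed by blast
    fix x assume x: "x \<in> N"
    then have "\<ominus>\<^bsub>M\<^esub> x = (\<ominus> \<one>) \<odot>\<^bsub>M\<^esub> x" using N.subset smult_minus_1 by auto
    then have "\<ominus>\<^bsub>M\<^esub> x \<in> N" using x by auto
    then show "inv\<^bsub>add_monoid M\<^esub> x \<in> N" by (simp add: a_inv_def)
  qed auto
  then show ?thesis
    by (intro abelian_subgroupI3 additive_subgroupI M.abelian_group_axioms)
qed

text \<open>If a map sends \<open>A\<close> into \<open>B\<close>, it sends all elements of one coset of \<open>A\<close> to elements of one
  coset of \<open>B\<close>, so the union of the cosets of their images is that coset. Both scalar multiplication on a
  quotient and the map induced on homology are defined by such unions.\<close>

lemma (in mod_hom) Union_cosets:
  assumes "submodule R A M" "submodule R B N" and AB: "f ` A \<subseteq> B" and x: "x \<in> carrier M"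
  shows "(\<Union>z \<in> A +>\<^bsub>M\<^esub> x. B +>\<^bsub>N\<^esub> f z) = B +>\<^bsub>N\<^esub> f x"
proof -
  interpret A: abelian_subgroup A M by (rule M.submodule_abelian_subgroup) fact
  interpret B: abelian_subgroup B N by (rule N.submodule_abelian_subgroup) fact
  have const: "B +>\<^bsub>N\<^esub> f z = B +>\<^bsub>N\<^esub> f x" if "z \<in> A +>\<^bsub>M\<^esub> x" for z
  proof -
    from that obtain a where a: "a \<in> A" "z = a \<oplus>\<^bsub>M\<^esub> x"
      by (auto simp: a_r_coset_def')
    then have "f z = f a \<oplus>\<^bsub>N\<^esub> f x" "f a \<in> B"
      using x A.a_subset AB by auto
    then show ?thesis
      using x by (intro N.M.a_repr_independence [symmetric] B.a_subgroup f_im) (auto simp: a_r_coset_def')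
  qed
  have "(\<Union>z \<in> A +>\<^bsub>M\<^esub> x. B +>\<^bsub>N\<^esub> f z) = (\<Union>z \<in> A +>\<^bsub>M\<^esub> x. B +>\<^bsub>N\<^esub> f x)"
    by (intro SUP_cong refl const)
  moreover have "A +>\<^bsub>M\<^esub> x \<noteq> {}" using A.a_rcos_self [OF x] by blast
  ultimately show ?thesis by simp
qed

text \<open>Makes \<open>Union_cosets\<close> applicable to the scalar multiplication of a quotient; commutativity of the
  ring enters here.\<close>

lemma (in module) smult_hom:
  assumes r: "r \<in> carrier R"
  shows "mod_hom R M M (\<lambda>x. r \<odot>\<^bsub>M\<^esub> x)"
proof -
  have "r \<odot>\<^bsub>M\<^esub> (t \<odot>\<^bsub>M\<^esub> x) = t \<odot>\<^bsub>M\<^esub> (r \<odot>\<^bsub>M\<^esub> x)" if "t \<in> carrier R" "x \<in> carrier M" for t x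
    using smult_assoc1 [OF r that] smult_assoc1 [OF that(1) r that(2)] R.m_comm [OF r that(1)] by simp
  then show ?thesis
    using r by (intro mod_hom.intro mod_hom_axioms.intro module_axioms) (auto simp: module_hom_def smult_r_distr)
qed

lemma quotient_carrier: "carrier (quotient_module M N) = {N +>\<^bsub>M\<^esub> x | x. x \<in> carrier M}"
  by (auto simp: quotient_module_def A_RCOSETS_def')

lemma quotient_zero: "\<zero>\<^bsub>quotient_module M N\<^esub> = N"
  by (simp add: quotient_module_def)

lemma (in module) quotient_add:
  assumes N: "submodule R N M" and "x \<in> carrier M" "y \<in> carrier M"
  shows "(N +>\<^bsub>M\<^esub> x) \<oplus>\<^bsub>quotient_module M N\<^esub> (N +>\<^bsub>M\<^esub> y) = N +>\<^bsub>M\<^esub> (x \<oplus>\<^bsub>M\<^esub> y)"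
proof -
  interpret N: abelian_subgroup N M using N by (rule submodule_abelian_subgroup)
  show ?thesis using assms by (simp add: quotient_module_def N.a_rcos_sum)
qed

lemma (in module) quotient_smult:
  assumes N: "submodule R N M" and r: "r \<in> carrier R" and x: "x \<in> carrier M"
  shows "r \<odot>\<^bsub>quotient_module M N\<^esub> (N +>\<^bsub>M\<^esub> x) = N +>\<^bsub>M\<^esub> (r \<odot>\<^bsub>M\<^esub> x)"
proof -
  interpret r: mod_hom R M M "\<lambda>x. r \<odot>\<^bsub>M\<^esub> x" using r by (rule smult_hom)
  interpret N: submodule R N M by fact
  show ?thesis using r.Union_cosets [OF N N _ x] r by (auto simp: quotient_module_def)
qed

lemma (in module) quotient_module_hom:
  assumes N: "submodule R N M"
  shows "mod_hom R M (quotient_module M N) (\<lambda>x. N +>\<^bsub>M\<^esub> x)"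
proof -
  interpret N: abelian_subgroup N M using N by (rule submodule_abelian_subgroup)
  have zero: "\<zero>\<^bsub>quotient_module M N\<^esub> = N +>\<^bsub>M\<^esub> \<zero>\<^bsub>M\<^esub>"
    using N.a_subset by (simp add: quotient_zero)
  note simps = quotient_carrier quotient_add [OF N] quotient_smult [OF N]
  have "module R (quotient_module M N)"
  proof (rule module_criteria)
    show "\<forall>X\<in>carrier (quotient_module M N). \<exists>Y\<in>carrier (quotient_module M N).
        X \<oplus>\<^bsub>quotient_module M N\<^esub> Y = \<zero>\<^bsub>quotient_module M N\<^esub>"
    proof
      fix X assume "X \<in> carrier (quotient_module M N)"
      then obtain x where x: "x \<in> carrier M" "X = N +>\<^bsub>M\<^esub> x" by (auto simp: quotient_carrier)
      show "\<exists>Y\<in>carrier (quotient_module M N). X \<oplus>\<^bsub>quotient_module M N\<^esub> Y = \<zero>\<^bsub>quotient_module M N\<^esub>"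
        by (rule bexI [of _ "N +>\<^bsub>M\<^esub> (\<ominus>\<^bsub>M\<^esub> x)"])
           (use x in \<open>auto simp: simps zero M.r_neg\<close>)
    qed
  qed (auto simp: simps zero M.a_ac smult_assoc1 smult_l_distr smult_r_distr R.cring_axioms)
  then show ?thesis
    by (intro mod_hom.intro mod_hom_axioms.intro module_axioms) (auto simp: module_hom_def simps)
qed

lemma (in module) submodule_trans:
  assumes "submodule R Z M" "submodule R B M" "B \<subseteq> Z"
  shows "submodule R B (M\<lparr>carrier := Z\<rparr>)"
proof -
  interpret Z: submodule R Z M by fact
  interpret B: submodule R B M by fact
  show ?thesis
    by (rule submodule.intro) (use assms submodule_is_module in auto)
qed

lemma a_r_coset_carrier_update [simp]: "B +>\<^bsub>M\<lparr>carrier := Z\<rparr>\<^esub> x = B +>\<^bsub>M\<^esub> x"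
  by (simp add: a_r_coset_def')

text \<open>The map induced on subquotients \<open>Z / B \<rightarrow> Z' / B'\<close>, in the form used for homology:
  cosets are taken in the submodules, but the union only refers to the ambient modules.\<close>

lemma (in mod_hom) induced_hom:
  assumes Z: "submodule R Z M" and B: "submodule R B M" and BZ: "B \<subseteq> Z"
    and Z': "submodule R Z' N" and B': "submodule R B' N" and BZ': "B' \<subseteq> Z'"
    and fZ: "f ` Z \<subseteq> Z'" and fB: "f ` B \<subseteq> B'"
  shows "(\<lambda>X. \<Union>z\<in>X. B' +>\<^bsub>N\<^esub> f z) \<in>
    module_hom R (quotient_module (M\<lparr>carrier := Z\<rparr>) B) (quotient_module (N\<lparr>carrier := Z'\<rparr>) B')"
proof -
  interpret Z: module R "M\<lparr>carrier := Z\<rparr>" using Z by (rule M.submodule_is_module)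
  interpret Z': module R "N\<lparr>carrier := Z'\<rparr>" using Z' by (rule N.submodule_is_module)
  have sub: "x \<in> carrier M" and fx: "f x \<in> Z'" if "x \<in> Z" for x
    using Z fZ that by (auto simp: submodule_def)
  note BM = M.submodule_trans [OF Z B BZ] and BN = N.submodule_trans [OF Z' B' BZ']
  define F where "F X = (\<Union>z\<in>X. B' +>\<^bsub>N\<^esub> f z)" for X
  have F: "F (B +>\<^bsub>M\<^esub> x) = B' +>\<^bsub>N\<^esub> f x" if "x \<in> Z" for x
    unfolding F_def using sub that by (intro Union_cosets [OF B B' fB])
  note q = Z.quotient_add [OF BM, simplified] Z.quotient_smult [OF BM, simplified]
     Z'.quotient_add [OF BN, simplified] Z'.quotient_smult [OF BN, simplified]
  have "F \<in> module_hom R (quotient_module (M\<lparr>carrier := Z\<rparr>) B) (quotient_module (N\<lparr>carrier := Z'\<rparr>) B')"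
    unfolding module_hom_def
  proof (intro CollectI conjI allI impI Pi_I; (elim conjE)?)
    fix X Y
    assume "X \<in> carrier (quotient_module (M\<lparr>carrier := Z\<rparr>) B)" "Y \<in> carrier (quotient_module (M\<lparr>carrier := Z\<rparr>) B)"
    then obtain x y where xy: "x \<in> Z" "y \<in> Z" "X = B +>\<^bsub>M\<^esub> x" "Y = B +>\<^bsub>M\<^esub> y"
      by (auto simp: quotient_carrier)
    moreover from this have "x \<oplus>\<^bsub>M\<^esub> y \<in> Z" using Z by (simp add: submodule_def)
    ultimately show "F (X \<oplus>\<^bsub>quotient_module (M\<lparr>carrier := Z\<rparr>) B\<^esub> Y) =
        F X \<oplus>\<^bsub>quotient_module (N\<lparr>carrier := Z'\<rparr>) B'\<^esub> F Y"
      using sub fx by (simp add: q F)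
  next
    fix r X assume r: "r \<in> carrier R" and "X \<in> carrier (quotient_module (M\<lparr>carrier := Z\<rparr>) B)"
    then obtain x where x: "x \<in> Z" "X = B +>\<^bsub>M\<^esub> x" by (auto simp: quotient_carrier)
    moreover from this r have "r \<odot>\<^bsub>M\<^esub> x \<in> Z" using Z by (simp add: submodule_def)
    ultimately show "F (r \<odot>\<^bsub>quotient_module (M\<lparr>carrier := Z\<rparr>) B\<^esub> X) =
        r \<odot>\<^bsub>quotient_module (N\<lparr>carrier := Z'\<rparr>) B'\<^esub> F X"
      using sub fx r by (simp add: q F)
  next
    fix X assume "X \<in> carrier (quotient_module (M\<lparr>carrier := Z\<rparr>) B)"
    then obtain x where "x \<in> Z" "X = B +>\<^bsub>M\<^esub> x" by (auto simp: quotient_carrier)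
    then show "F X \<in> carrier (quotient_module (N\<lparr>carrier := Z'\<rparr>) B')"
      using F fx by (auto simp: quotient_carrier)
  qed
  then show ?thesis by (simp add: F_def [abs_def])
qed

text \<open>An independent subset of \<open>W\<close> is independent in \<open>V\<close>, so its size is at most the dimension of
  \<open>V\<close>. A largest one is a basis of \<open>W\<close>.\<close>

lemma (in vectorspace) subspace_fin_dim:
  assumes W: "subspace K W V" and fd: "fin_dim"
  shows "vectorspace.fin_dim K (vs W)"
proof -
  interpret W: vectorspace K "vs W" using W by (rule subspace_is_vs)
  have sub: "submodule K W V" using W by (rule is_module)
  then have WV: "W \<subseteq> carrier V" by (simp add: submodule_def)
  have li: "finite A \<and> card A \<le> dim" if "A \<subseteq> carrier (vs W) \<and> W.lin_indpt A" for A
    using that span_li_not_depend(2) [OF _ sub, of A] li_le_dim [OF fd, of A] WV by auto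
  have "{} \<subseteq> carrier (vs W) \<and> W.lin_indpt {}" by (auto simp: W.lin_dep_def)
  then obtain A where "finite A" "maximal A (\<lambda>S. S \<subseteq> carrier (vs W) \<and> W.lin_indpt S)"
    using maximal_exists [where P = "\<lambda>S. S \<subseteq> carrier (vs W) \<and> W.lin_indpt S" and N = dim] li
    by blast
  then have "finite A" "W.basis A" using W.max_li_is_basis by auto
  then show ?thesis by (auto simp: W.fin_dim_def W.basis_def)
qed

text \<open>Rank-nullity for the projection, which is onto and has kernel \<open>N\<close>.\<close>

lemma (in vectorspace) dim_quotient:
  assumes N: "subspace K N V" and fd: "fin_dim"
  shows "vectorspace.dim K (quotient_module V N) + vectorspace.dim K (vs N) = dim"
proof -
  have sub: "submodule K N V" using N by (rule is_module)
  interpret N: abelian_subgroup N V using sub by (rule submodule_abelian_subgroup)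
  interpret q: mod_hom K V "quotient_module V N" "\<lambda>x. N +>\<^bsub>V\<^esub> x" using sub by (rule quotient_module_hom)
  interpret q: linear_map K V "quotient_module V N" "\<lambda>x. N +>\<^bsub>V\<^esub> x" by unfold_locales
  have im: "q.im = carrier (quotient_module V N)" by (auto simp: q.im_def quotient_carrier)
  have "N +>\<^bsub>V\<^esub> x = N \<longleftrightarrow> x \<in> N" if "x \<in> carrier V" for x
    using that N.a_subgroup a_coset_join1 a_coset_join2 by blast
  then have ker: "q.ker = N" using N.a_subset by (auto simp: q.ker_def quotient_zero)
  show ?thesis using q.rank_nullity [OF fd] by (simp add: im ker)
qed

lemma (in vectorspace) dim_zero_carrier:
  assumes "carrier V = {\<zero>\<^bsub>V\<^esub>}"
  shows "dim = 0"
proof (rule dim0I, rule antisym)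
  show "span {\<zero>\<^bsub>V\<^esub>} \<subseteq> carrier V" by (rule span_is_subset2) simp
  show "carrier V \<subseteq> span {\<zero>\<^bsub>V\<^esub>}" unfolding assms by (rule in_own_span) simp
qed

section \<open>The Euler-Poincare formula\<close>

lemma linear_mapI: "mod_hom K V W T \<Longrightarrow> field K \<Longrightarrow> linear_map K V W T"
  unfolding linear_map_def mod_hom_def vectorspace_def by simp

text \<open>With \<open>b i\<close> the dimension of the boundaries, rank-nullity gives
  \<open>dim H i = dim C i - b (Suc i) - b i\<close>. In the alternating sum the terms \<open>b\<close> telescope, leaving
  \<open>b 0\<close> and \<open>b (Suc n)\<close>, which both vanish.\<close>

lemma euler_poincare:
  fixes C :: "nat \<Rightarrow> ('k, 'v, 'm) module_scheme"
  assumes "field K"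
    and d: "\<And>i. mod_hom K (C i) (C (Suc i)) (d i)"
    and fd: "\<And>i. vectorspace.fin_dim K (C i)"
    and dd: "\<And>i x. x \<in> carrier (C i) \<Longrightarrow> d (Suc i) (d i x) = \<zero>\<^bsub>C (Suc (Suc i))\<^esub>"
    and top: "carrier (C (Suc n)) = {\<zero>\<^bsub>C (Suc n)\<^esub>}"
    and B0: "B 0 = {\<zero>\<^bsub>C 0\<^esub>}" and BSuc: "\<And>i. B (Suc i) = mod_hom.im (C i) (d i)"
  shows "(\<Sum>i\<le>n. (-1) ^ i * int (vectorspace.dim K
             (quotient_module ((C i)\<lparr>carrier := mod_hom.ker (C i) (C (Suc i)) (d i)\<rparr>) (B i))))
       = (\<Sum>i\<le>n. (-1) ^ i * int (vectorspace.dim K (C i)))"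
proof -
  interpret field K by fact
  have lin: "linear_map K (C i) (C (Suc i)) (d i)" for i
    using d \<open>field K\<close> by (rule linear_mapI)
  then have vs: "vectorspace K (C i)" for i by (simp add: linear_map_def)
  define Z where "Z i = mod_hom.ker (C i) (C (Suc i)) (d i)" for i
  define b where "b i = int (vectorspace.dim K ((C i)\<lparr>carrier := B i\<rparr>))" for i
  have Z: "Z i = {x \<in> carrier (C i). d i x = \<zero>\<^bsub>C (Suc i)\<^esub>}" for i
    using mod_hom.ker_def [OF d] by (simp add: Z_def)
  have zero: "d i \<zero>\<^bsub>C i\<^esub> = \<zero>\<^bsub>C (Suc i)\<^esub>" for i using mod_hom.f0_is_0 [OF d] .
  have zeroC: "\<zero>\<^bsub>C i\<^esub> \<in> carrier (C i)" for i
  proof -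
    interpret vectorspace K "C i" by (rule vs)
    show ?thesis by (rule M.zero_closed)
  qed
  have subB: "submodule K (B i) (C i)" for i
  proof (cases i)
    case 0
    interpret vectorspace K "C 0" by (rule vs)
    show ?thesis unfolding 0 B0 by unfold_locales auto
  next
    case (Suc j)
    interpret linear_map K "C j" "C (Suc j)" "d j" by (rule lin)
    show ?thesis unfolding Suc BSuc by (rule im_is_submodule)
  qed
  have h: "int (vectorspace.dim K (quotient_module ((C i)\<lparr>carrier := Z i\<rparr>) (B i))) =
      int (vectorspace.dim K (C i)) - b (Suc i) - b i" for i
  proof -
    interpret linear_map K "C i" "C (Suc i)" "d i" by (rule lin)
    interpret Z: vectorspace K "(C i)\<lparr>carrier := Z i\<rparr>"
      unfolding Z_def by (intro V.subspace_is_vs kerT_is_subspace)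
    have BZ: "B i \<subseteq> Z i"
    proof (cases i)
      case 0
      then show ?thesis using B0 by (simp add: Z zero zeroC)
    next
      case (Suc j)
      interpret j: linear_map K "C j" "C (Suc j)" "d j" by (rule lin)
      show ?thesis using dd Suc by (auto simp: BSuc Z j.im_def)
    qed
    have "subspace K (B i) ((C i)\<lparr>carrier := Z i\<rparr>)"
      unfolding subspace_def
      by (intro conjI Z.vectorspace_axioms V.module.submodule_trans subB BZ)
         (auto simp: Z_def intro: ker_is_submodule)
    moreover have "Z.fin_dim"
      unfolding Z_def by (intro V.subspace_fin_dim kerT_is_subspace fd)
    ultimately have "vectorspace.dim K (quotient_module ((C i)\<lparr>carrier := Z i\<rparr>) (B i)) +
        vectorspace.dim K ((C i)\<lparr>carrier := B i\<rparr>) = Z.dim"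
      using Z.dim_quotient [of "B i"] by simp
    moreover have "vectorspace.dim K ((C (Suc i))\<lparr>carrier := B (Suc i)\<rparr>) + Z.dim = V.dim"
      using rank_nullity [OF fd] by (simp add: BSuc Z_def)
    ultimately show ?thesis unfolding b_def by linarith
  qed
  have b_zero: "b i = 0" if "B i = {\<zero>\<^bsub>C i\<^esub>}" for i
  proof -
    interpret vectorspace K "C i" by (rule vs)
    interpret B: vectorspace K "(C i)\<lparr>carrier := B i\<rparr>"
      by (intro subspace_is_vs) (simp add: subspace_def subB vectorspace_axioms)
    show ?thesis using B.dim_zero_carrier that by (simp add: b_def)
  qed
  have "B (Suc n) = {\<zero>\<^bsub>C (Suc n)\<^esub>}"
  proof -
    interpret submodule K "B (Suc n)" "C (Suc n)" by (rule subB)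
    show ?thesis using subset top zero_closed by blast
  qed
  then have b0: "b 0 = 0" "b (Suc n) = 0" using B0 b_zero by blast+
  have "(\<Sum>i\<le>m. (-1) ^ i * (int (vectorspace.dim K (C i)) - b (Suc i) - b i)) =
      (\<Sum>i\<le>m. (-1) ^ i * int (vectorspace.dim K (C i))) - b 0 - (-1) ^ m * b (Suc m)" for m
    by (induction m) (auto simp: algebra_simps)
  then show ?thesis using h b0 by (simp add: Z_def)
qed

section \<open>Dimension of free modules\<close>

lemma (in cring) generator_inj:
  assumes "\<one> \<noteq> \<zero>"
  shows "inj_on (generator R A) A"
proof (rule inj_onI)
  fix a b assume ab: "a \<in> A" "b \<in> A" and eq: "generator R A a = generator R A b"
  have "generator R A b a = \<one>" using ab fun_cong [OF eq, of a] by (simp add: generator_def)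
  then show "a = b" using ab assms by (auto simp: generator_def split: if_splits)
qed

lemma (in field) dim_func_space:
  assumes A: "finite A"
  shows "vectorspace.fin_dim R (func_space A)" "vectorspace.dim R (func_space A) = card A"
proof -
  interpret V: vectorspace R "func_space A"
    by (intro vectorspace.intro func_space_is_module field_axioms)
  let ?G = "generator R A ` A"
  have inj: "inj_on (generator R A) A" by (rule generator_inj) simp
  have G: "?G \<subseteq> carrier (func_space A)" by auto
  have lc: "V.lincomb c ?G = (\<lambda>a\<in>A. c (generator R A a))" if "c \<in> ?G \<rightarrow> carrier R" for c
  proof -
    let ?c = "\<lambda>a\<in>A. c (generator R A a)"
    have cl: "c (generator R A a) \<in> carrier R" if "a \<in> A" for a using \<open>c \<in> _\<close> that by blast
    have "V.lincomb c ?G = finsum (func_space A) (\<lambda>a. c (generator R A a) \<odot>\<^bsub>func_space A\<^esub> generator R A a) A"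
      unfolding V.lincomb_def using cl inj by (intro V.M.finsum_reindex) auto
    also have "\<dots> = linear_extension A (func_space A) (generator R A) ?c"
      unfolding linear_extension_def using cl by (intro V.M.finsum_cong') auto
    also have "\<dots> = ?c" using cl by (intro generator_expansion A) (auto simp: func_space_carrier)
    finally show ?thesis .
  qed
  have "V.lin_indpt ?G"
  proof (rule V.finite_lin_indpt2)
    fix c assume c: "c \<in> ?G \<rightarrow> carrier R" and "V.lincomb c ?G = \<zero>\<^bsub>func_space A\<^esub>"
    then have "(\<lambda>a\<in>A. c (generator R A a)) = (\<lambda>a\<in>A. \<zero>)" by (simp add: lc func_space_zero)
    then show "\<forall>v\<in>?G. c v = \<zero>" by (auto simp: fun_eq_iff restrict_def) metis
  qed (use A G in auto)
  moreover have "carrier (func_space A) \<subseteq> V.span ?G"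
  proof
    fix c assume c: "c \<in> carrier (func_space A)"
    let ?c = "\<lambda>v. c (the_inv_into A (generator R A) v)"
    have inv: "the_inv_into A (generator R A) (generator R A a) = a" if "a \<in> A" for a
      using inj that by (rule the_inv_into_f_f)
    have cl: "?c \<in> ?G \<rightarrow> carrier R" using c by (auto simp: inv func_space_carrier PiE_iff)
    have "V.lincomb ?c ?G = c"
      unfolding lc [OF cl] using c by (auto simp: inv func_space_carrier fun_eq_iff PiE_iff extensional_def)
    then show "c \<in> V.span ?G" using cl A by (subst V.finite_span) (auto intro!: exI[of _ ?c])
  qed
  ultimately have basis: "V.basis ?G"
    using V.span_is_subset2 [OF G] G by (auto simp: V.basis_def)
  show "V.fin_dim" using basis A by (auto simp: V.fin_dim_def V.basis_def)
  show "V.dim = card A" using V.dim_basis [OF _ basis] A inj by (simp add: card_image)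
qed

section \<open>Components and connected dominating sets\<close>

abbreviation linked :: "'a pair_pre_digraph \<Rightarrow> 'a set \<Rightarrow> 'a \<Rightarrow> 'a \<Rightarrow> bool" where
  "linked G S u v \<equiv> u \<rightarrow>\<^sup>*\<^bsub>with_proj G \<restriction> S\<^esub> v"

lemma arcs_ends_induced: "arcs_ends (with_proj G \<restriction> S) = {(u, v) \<in> parcs G. u \<in> S \<and> v \<in> S}"
  by (force simp: arcs_ends_conv)

lemma linked_def: "linked G S u v \<longleftrightarrow> (u, v) \<in> rtrancl_on S {(u, v) \<in> parcs G. u \<in> S \<and> v \<in> S}"
  by (simp add: reachable_def arcs_ends_induced)

lemma linked_in: "linked G S u v \<Longrightarrow> u \<in> S \<and> v \<in> S"
  unfolding linked_def by (blast dest: in_rtrancl_on_in_F)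

lemma linked_refl: "u \<in> S \<Longrightarrow> linked G S u u"
  unfolding linked_def by simp

lemma linked_trans: "linked G S u v \<Longrightarrow> linked G S v w \<Longrightarrow> linked G S u w"
  unfolding linked_def by (rule rtrancl_on_trans)

lemma linked_step: "linked G S u v \<Longrightarrow> (v, w) \<in> parcs G \<Longrightarrow> w \<in> S \<Longrightarrow> linked G S u w"
  unfolding linked_def by (rule rtrancl_on_into_rtrancl_on) (auto dest: in_rtrancl_on_in_F)

lemma linked_induct [consumes 1, case_names base step]:
  assumes "linked G S u v" "P u"
    and "\<And>v w. linked G S u v \<Longrightarrow> (v, w) \<in> parcs G \<Longrightarrow> v \<in> S \<Longrightarrow> w \<in> S \<Longrightarrow> P v \<Longrightarrow> P w"
  shows "P v"
  using assms(1) unfolding linked_def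
  by (induction rule: rtrancl_on_induct) (use assms(2,3) in \<open>auto simp: linked_def\<close>)

lemma pair_graph_sym: "pair_graph G \<Longrightarrow> (u, v) \<in> parcs G \<Longrightarrow> (v, u) \<in> parcs G"
  by (meson pair_graph_def pair_pseudo_graph_def pair_sym_digraph.arcs_symmetric)

lemma linked_sym:
  assumes "pair_graph G" "linked G S u v"
  shows "linked G S v u"
proof -
  have "sym {(u, v) \<in> parcs G. u \<in> S \<and> v \<in> S}"
    using pair_graph_sym [OF assms(1)] by (auto simp: sym_def)
  then show ?thesis using assms(2) unfolding linked_def by (meson rtrancl_on_sym symE)
qed

lemma linked_image:
  assumes f: "\<And>u v. (u, v) \<in> parcs G \<Longrightarrow> (f u, f v) \<in> parcs H" and S: "f ` S \<subseteq> T" and l: "linked G S u v"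
  shows "linked H T (f u) (f v)"
  using l
proof (induction rule: linked_induct)
  case base
  then show ?case using S l linked_in by (fastforce intro: linked_refl)
next
  case (step v w)
  have "f w \<in> T" using step(4) S by blast
  with step(5) f [OF step(2)] show ?case by (rule linked_step)
qed

lemma linked_mono: "linked G S u v \<Longrightarrow> S \<subseteq> T \<Longrightarrow> linked G T u v"
  using linked_image [of G "\<lambda>x. x" G S T u v] by simp

lemma connected_induced_iff:
  assumes "pair_graph G"
  shows "Digraph_Component.connected (with_proj G \<restriction> S) \<longleftrightarrow> S \<noteq> {} \<and> (\<forall>u \<in> S. \<forall>v \<in> S. linked G S u v)"
proof -
  have "arcs_ends (with_proj (mk_symmetric (with_proj G \<restriction> S))) = arcs_ends (with_proj G \<restriction> S)"
    using pair_graph_sym [OF assms] by (auto simp: mk_symmetric_def arcs_ends_induced)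
  moreover have "verts (with_proj (mk_symmetric (with_proj G \<restriction> S))) = S"
    by (simp add: mk_symmetric_def)
  ultimately show ?thesis
    by (simp add: Digraph_Component.connected_def strongly_connected_def reachable_def)
qed

lemma components_def': "components G S = {x. x \<noteq> {} \<and> (\<forall>u\<in>x. \<forall>v\<in>x. linked G S u v) \<and>
    (\<forall>u\<in>x. \<forall>v. v \<notin> x \<longrightarrow> \<not> linked G S u v \<or> \<not> linked G S v u)}"
  by (simp add: components_def pre_digraph.sccs_verts_def)

lemma components_nonempty: "x \<in> components G S \<Longrightarrow> x \<noteq> {}"
  by (simp add: components_def')

lemma components_subset: "x \<in> components G S \<Longrightarrow> x \<subseteq> S"
  unfolding components_def' using linked_in by fast

lemma components_linked: "x \<in> components G S \<Longrightarrow> u \<in> x \<Longrightarrow> v \<in> x \<Longrightarrow> linked G S u v"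
  by (simp add: components_def')

text \<open>Components are defined by reachability in both directions; by symmetry, one direction
  is enough.\<close>

lemma components_closed:
  assumes "pair_graph G" "x \<in> components G S" "u \<in> x" "linked G S u v"
  shows "v \<in> x"
  using assms linked_sym [OF assms(1,4)] by (auto simp: components_def')

text \<open>This describes a component without reference to paths in \<open>S\<close>: a path of \<open>S\<close> that starts in
  a component never leaves it. The only conditions that relate \<open>x\<close> to \<open>S\<close> are then \<open>x \<subseteq> S\<close> and
  the absence of edges, which makes it possible to count the sets \<open>S\<close> for a given \<open>x\<close>.\<close>

lemma components_iff:
  assumes G: "pair_graph G"
  shows "x \<in> components G S \<longleftrightarrow> x \<subseteq> S \<and> Digraph_Component.connected (with_proj G \<restriction> x) \<and>
           (\<forall>u \<in> x. \<forall>v \<in> S - x. (u, v) \<notin> parcs G)"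
proof
  assume x: "x \<in> components G S"
  have "linked G x u v" if "u \<in> x" "v \<in> x" for u v
    using components_linked [OF x that]
  proof (induction rule: linked_induct)
    case base
    show ?case using that by (intro linked_refl)
  next
    case (step v w)
    have "linked G S u w" using step(1,2,4) by (rule linked_step)
    then have "w \<in> x" using components_closed [OF G x that(1)] by blast
    with step(5,2) show ?case by (rule linked_step)
  qed
  moreover have "(u, v) \<notin> parcs G" if uv: "u \<in> x" "v \<in> S - x" for u v
  proof
    assume "(u, v) \<in> parcs G"
    moreover have "linked G S u u" using uv components_subset [OF x] by (intro linked_refl) auto
    moreover have "v \<in> S" using uv by blast
    ultimately have "linked G S u v" using linked_step [of G S u u v] by blast
    then show False using uv components_closed [OF G x] by auto
  qed
  ultimately show "x \<subseteq> S \<and> Digraph_Component.connected (with_proj G \<restriction> x) \<and>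
           (\<forall>u \<in> x. \<forall>v \<in> S - x. (u, v) \<notin> parcs G)"
    using components_subset [OF x] components_nonempty [OF x] by (auto simp: connected_induced_iff [OF G])
next
  assume x: "x \<subseteq> S \<and> Digraph_Component.connected (with_proj G \<restriction> x) \<and>
           (\<forall>u \<in> x. \<forall>v \<in> S - x. (u, v) \<notin> parcs G)"
  \<comment> \<open>No path inside \<open>S\<close> leaves \<open>x\<close>.\<close>
  have stay: "v \<in> x" if "u \<in> x" "linked G S u v" for u v
    using that(2) by (induction rule: linked_induct) (use x that(1) in blast)+
  have inner: "linked G S u v" if "u \<in> x" "v \<in> x" for u v
    by (rule linked_mono [of G x]) (use x that in \<open>auto simp: connected_induced_iff [OF G]\<close>)
  show "x \<in> components G S"
    unfolding components_def'
  proof (intro CollectI conjI ballI allI impI disjI1)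
    show "x \<noteq> {}" using x connected_induced_iff [OF G] by blast
  qed (use stay inner in blast)+
qed

text \<open>The functor of components on inclusions and, for \<open>x\<close> the image of a component under a morphism,
  on injective morphisms.\<close>

definition component_above :: "'a pair_pre_digraph \<Rightarrow> 'a set \<Rightarrow> 'a set \<Rightarrow> 'a set" where
  "component_above G S x = (THE y. y \<in> components G S \<and> x \<subseteq> y)"

lemma component_above_eq:
  assumes G: "pair_graph G" and y: "y \<in> components G S" "x \<subseteq> y" and x: "x \<noteq> {}"
  shows "component_above G S x = y"
  unfolding component_above_def
proof (rule the_equality)
  show "y \<in> components G S \<and> x \<subseteq> y" using y by blast
  fix z assume z: "z \<in> components G S \<and> x \<subseteq> z"
  obtain u where u: "u \<in> x" using x by blast
  have "v \<in> y" if "v \<in> z" for v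
  proof -
    have "linked G S u v" using z u that by (auto intro: components_linked)
    then show ?thesis using components_closed [OF G y(1)] y u by auto
  qed
  moreover have "v \<in> z" if "v \<in> y" for v
  proof -
    have "linked G S u v" using y u that by (auto intro: components_linked)
    then show ?thesis using components_closed [OF G] z u by auto
  qed
  ultimately show "z = y" by blast
qed

lemma component_above:
  assumes G: "pair_graph G" and "x \<noteq> {}" and x: "\<And>u v. u \<in> x \<Longrightarrow> v \<in> x \<Longrightarrow> linked G S u v"
  shows "component_above G S x \<in> components G S" "x \<subseteq> component_above G S x"
proof -
  obtain u where u: "u \<in> x" using assms by blast
  let ?y = "{v. linked G S u v}"
  have 1: "linked G S v w" if "linked G S u v" "linked G S u w" for v w
    using linked_trans [OF linked_sym [OF G that(1)] that(2)] .
  have 2: "linked G S u w" if "linked G S u v" "linked G S v w" for v w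
    using that by (rule linked_trans)
  have "linked G S u u" using u x by auto
  then have "?y \<noteq> {}" by auto
  moreover have "\<forall>v\<in>?y. \<forall>w\<in>?y. linked G S v w" using 1 by auto
  moreover have "\<forall>v\<in>?y. \<forall>w. w \<notin> ?y \<longrightarrow> \<not> linked G S v w \<or> \<not> linked G S w v"
    using 2 by (metis (no_types, lifting) mem_Collect_eq)
  ultimately have "?y \<in> components G S" unfolding components_def' by (intro CollectI conjI)
  moreover have "x \<subseteq> ?y" using u x by blast
  ultimately show "component_above G S x \<in> components G S" "x \<subseteq> component_above G S x"
    using component_above_eq [OF G _ _ assms(2)] by auto
qed

lemma component_above_mono:
  assumes G: "pair_graph G" and x: "x \<in> components G S" and "S \<subseteq> T"
  shows "component_above G T x \<in> components G T" "x \<subseteq> component_above G T x"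
proof -
  have "linked G T u v" if "u \<in> x" "v \<in> x" for u v
    using components_linked [OF x that] assms(3) by (rule linked_mono)
  from component_above [OF G components_nonempty [OF x] this]
  show "component_above G T x \<in> components G T" "x \<subseteq> component_above G T x" by auto
qed

lemma component_above_image:
  assumes H: "pair_graph H" and f: "inj_morphism G H f" and x: "x \<in> components G S" and S: "f ` S \<subseteq> T"
  shows "component_above H T (f ` x) \<in> components H T" "f ` x \<subseteq> component_above H T (f ` x)"
proof -
  have "linked H T (f u) (f v)" if "u \<in> x" "v \<in> x" for u v
    using f components_linked [OF x that] S by (intro linked_image [of G f H]) (auto simp: inj_morphism_def)
  then have "linked H T u v" if "u \<in> f ` x" "v \<in> f ` x" for u v using that by auto
  then show "component_above H T (f ` x) \<in> components H T" "f ` x \<subseteq> component_above H T (f ` x)"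
    using component_above [OF H, of "f ` x"] components_nonempty [OF x] by auto
qed

lemma sum_neg_one_Pow:
  assumes "finite A"
  shows "(\<Sum>T \<in> Pow A. (-1 :: int) ^ card T) = (if A = {} then 1 else 0)"
  using assms
proof (induction A)
  case (insert a A)
  have "(\<Sum>T \<in> Pow (insert a A). (-1 :: int) ^ card T) =
      (\<Sum>T \<in> Pow A. (-1) ^ card T) + (\<Sum>T \<in> insert a ` Pow A. (-1) ^ card T)"
    unfolding Pow_insert using insert by (intro sum.union_disjoint) auto
  also have "(\<Sum>T \<in> insert a ` Pow A. (-1 :: int) ^ card T) = (\<Sum>T \<in> Pow A. (-1) ^ card (insert a T))"
    using insert by (intro sum.reindex_cong [of "insert a"]) (auto simp: inj_on_def)
  also have "\<dots> = (\<Sum>T \<in> Pow A. - ((-1) ^ card T))"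
    using insert by (intro sum.cong) (auto simp: card_insert_if finite_subset)
  finally show ?case by (simp add: sum_negf)
qed simp

lemma sum_neg_one_card_fibres:
  assumes "finite P" "\<And>p. p \<in> P \<Longrightarrow> c p \<le> n"
  shows "(\<Sum>i\<le>n. (-1 :: int) ^ i * int (card {p \<in> P. c p = i})) = (\<Sum>p\<in>P. (-1) ^ c p)"
proof -
  have "(\<Sum>i\<le>n. (-1 :: int) ^ i * int (card {p \<in> P. c p = i})) = (\<Sum>i\<le>n. \<Sum>p | p \<in> P \<and> c p = i. (-1) ^ c p)"
    by (intro sum.cong) auto
  also have "\<dots> = (\<Sum>p\<in>P. (-1) ^ c p)" using assms by (intro sum.group) auto
  finally show ?thesis .
qed

text \<open>The sets in the sum are the unions of \<open>x\<close> with an arbitrary subset of the set \<open>U\<close> of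
  vertices that are outside \<open>x\<close> and not adjacent to it. The alternating sum over the subsets of \<open>U\<close>
  vanishes unless \<open>U\<close> is empty, that is, unless \<open>x\<close> is dominating.\<close>

lemma alternating_supersets_of_component:
  assumes G: "pair_graph G" and x: "x \<subseteq> pverts G"
  shows "(\<Sum>S | x \<subseteq> S \<and> S \<subseteq> pverts G \<and> (\<forall>u \<in> x. \<forall>v \<in> S - x. (u, v) \<notin> parcs G). (-1 :: int) ^ card S) =
    (if dominating G x then (-1) ^ card x else 0)"
proof -
  interpret pair_graph G by fact
  \<comment> \<open>The vertices that may be added to \<open>x\<close> without changing its being a component.\<close>
  define U where "U = {v \<in> pverts G - x. \<forall>u \<in> x. (u, v) \<notin> parcs G}"
  have fin: "finite U" "finite x" using x pair_finite_verts by (auto simp: U_def intro: finite_subset)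
  have "{S. x \<subseteq> S \<and> S \<subseteq> pverts G \<and> (\<forall>u \<in> x. \<forall>v \<in> S - x. (u, v) \<notin> parcs G)} = (\<lambda>T. x \<union> T) ` Pow U"
    (is "?F = _")
  proof (intro equalityI subsetI)
    fix S assume "S \<in> ?F"
    then have "S = x \<union> (S - x)" "S - x \<in> Pow U" by (auto simp: U_def)
    then show "S \<in> (\<lambda>T. x \<union> T) ` Pow U" by blast
  qed (use x in \<open>auto simp: U_def\<close>)
  then have "(\<Sum>S\<in>?F. (-1 :: int) ^ card S) = (\<Sum>T\<in>Pow U. (-1) ^ card (x \<union> T))"
    by (intro sum.reindex_cong [of "\<lambda>T. x \<union> T"]) (auto simp: inj_on_def U_def)
  also have "\<dots> = (\<Sum>T\<in>Pow U. (-1) ^ card x * (-1) ^ card T)"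
  proof (rule sum.cong [OF refl])
    fix T assume T: "T \<in> Pow U"
    then have "card (x \<union> T) = card x + card T"
      using fin finite_subset [of T U] by (intro card_Un_disjoint) (auto simp: U_def)
    then show "(-1 :: int) ^ card (x \<union> T) = (-1) ^ card x * (-1) ^ card T" by (simp add: power_add)
  qed
  also have "\<dots> = (if U = {} then (-1) ^ card x else 0)"
    by (simp add: sum_distrib_left [symmetric] sum_neg_one_Pow fin)
  also have "U = {} \<longleftrightarrow> dominating G x"
  proof -
    have "(u, v) \<in> parcs G \<longleftrightarrow> (v, u) \<in> parcs G" for u v using arcs_symmetric by blast
    then show ?thesis unfolding U_def dominating_def using x by blast
  qed
  finally show ?thesis .
qed

lemma finite_bold_gens:
  assumes "pair_graph G"
  shows "finite (bold_gens G i)"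
proof -
  interpret pair_graph G by fact
  have "bold_gens G i \<subseteq> Pow (pverts G) \<times> Pow (pverts G)"
    unfolding bold_gens_def using components_subset by fast
  then show ?thesis by (rule finite_subset) (simp add: pair_finite_verts)
qed

lemma bold_gens_above_top:
  assumes "pair_graph G"
  shows "bold_gens G (Suc (card (pverts G))) = {}"
proof -
  interpret pair_graph G by fact
  have "card S \<noteq> Suc (card (pverts G))" if "S \<subseteq> pverts G" for S
    using card_mono [OF pair_finite_verts that] by simp
  then show ?thesis by (auto simp: bold_gens_def)
qed

text \<open>Both sides are sums over pairs and sets, graded by cardinality. The left-hand sum over pairs
  \<open>(S, x)\<close> is evaluated with \<open>x\<close> as the outer variable.\<close>

lemma euler_bold_gens:
  assumes G: "pair_graph G"
  shows "(\<Sum>i\<le>card (pverts G). (-1) ^ i * int (card (bold_gens G i))) = poly (conn_dom_poly G) (-1)"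
proof -
  interpret pair_graph G by fact
  note fin = pair_finite_verts
  let ?V = "pverts G" and ?conn = "\<lambda>x. Digraph_Component.connected (with_proj G \<restriction> x)"
  define P where "P = {(S, x). S \<subseteq> ?V \<and> x \<in> components G S}"
  define X where "X = {x. x \<subseteq> ?V \<and> ?conn x}"
  define F where "F x = {S. x \<subseteq> S \<and> S \<subseteq> ?V \<and> (\<forall>u \<in> x. \<forall>v \<in> S - x. (u, v) \<notin> parcs G)}" for x
  have "P \<subseteq> Pow ?V \<times> Pow ?V" using components_subset by (fastforce simp: P_def)
  then have finP: "finite P" by (rule finite_subset) (simp add: fin)
  have finX: "finite X" and finF: "finite (F x)" for x
    by (rule finite_subset [of _ "Pow ?V"]; auto simp: X_def F_def fin)+
  have gens: "bold_gens G i = {p \<in> P. card (fst p) = i}" for i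
    by (auto simp: bold_gens_def P_def)
  have "(\<Sum>i\<le>card ?V. (-1) ^ i * int (card (bold_gens G i))) = (\<Sum>p\<in>P. (-1) ^ card (fst p))"
    unfolding gens using finP by (rule sum_neg_one_card_fibres) (auto simp: P_def fin card_mono)
  also have "\<dots> = (\<Sum>(x, S)\<in>Sigma X F. (-1) ^ card S)"
    by (intro sum.reindex_bij_witness [of _ prod.swap prod.swap])
       (auto simp: P_def X_def F_def components_iff [OF G])
  also have "\<dots> = (\<Sum>x\<in>X. \<Sum>S\<in>F x. (-1) ^ card S)"
    using finX finF by (subst sum.Sigma) auto
  also have "\<dots> = (\<Sum>x\<in>X. if dominating G x then (-1) ^ card x else 0)"
    unfolding F_def using alternating_supersets_of_component [OF G] by (intro sum.cong) (auto simp: X_def)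
  also have "\<dots> = (\<Sum>x\<in>{D. connected_dominating G D}. (-1) ^ card x)"
    using finX by (simp add: sum.inter_filter [symmetric])
      (rule sum.cong, auto simp: X_def connected_dominating_def dominating_def)
  also have "\<dots> = (\<Sum>i\<le>card ?V. (-1) ^ i * int (card {D \<in> {D. connected_dominating G D}. card D = i}))"
    by (rule sum_neg_one_card_fibres [symmetric])
       (auto simp: connected_dominating_def dominating_def fin card_mono intro: finite_subset [of _ "Pow ?V"])
  also have "\<dots> = poly (conn_dom_poly G) (-1)"
    by (simp add: conn_dom_poly_def poly_sum poly_monom mult.commute)
  finally show ?thesis .
qed

section \<open>Signs on a cube\<close>

text \<open>The cube of subsets of \<open>V\<close> is contractible: a function on its edges whose sum around every
  square is zero has a potential \<open>\<sigma>\<close>. It is built downwards from \<open>V\<close>. At each new set \<open>S\<close> some vertex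
  \<open>v\<close> is chosen to define \<open>\<sigma> S\<close> from the value one level up, and the condition on the square spanned by
  \<open>v\<close> and \<open>w\<close> shows that \<open>w\<close> would have given the same value.\<close>

lemma cube_cocycle_is_coboundary:
  fixes c :: "'a set \<Rightarrow> 'a set \<Rightarrow> bit"
  assumes "finite V"
    and c: "\<And>S v w. \<lbrakk>S \<subseteq> V; v \<in> V - S; w \<in> V - S; v \<noteq> w\<rbrakk> \<Longrightarrow>
       c S (insert v S) + c (insert v S) (insert w (insert v S)) =
       c S (insert w S) + c (insert w S) (insert w (insert v S))"
  shows "\<exists>\<sigma>. \<sigma> V = 0 \<and> (\<forall>S v. S \<subseteq> V \<and> v \<in> V - S \<longrightarrow> \<sigma> S = c S (insert v S) + \<sigma> (insert v S))"
proof -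
  have card_less: "card (V - insert v S) < card (V - S)" if "v \<in> V - S" for v S
    using that assms(1) by (intro psubset_card_mono) auto
  have "\<exists>\<sigma>. \<sigma> V = 0 \<and> (\<forall>S v. S \<subseteq> V \<and> v \<in> V - S \<and> card (V - S) \<le> n \<longrightarrow> \<sigma> S = c S (insert v S) + \<sigma> (insert v S))" for n
  proof (induction n)
    case 0
    have "V - S = {}" if "card (V - S) = 0" for S using that assms(1) by simp
    then show ?case by (intro exI [of _ "\<lambda>_. 0"]) auto
  next
    case (Suc n)
    then obtain \<sigma> where \<sigma>: "\<sigma> V = 0"
      and step: "\<And>S v. \<lbrakk>S \<subseteq> V; v \<in> V - S; card (V - S) \<le> n\<rbrakk> \<Longrightarrow> \<sigma> S = c S (insert v S) + \<sigma> (insert v S)"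
      by blast
    \<comment> \<open>One more level of the cube, with an arbitrary choice of the edge leading up.\<close>
    define \<tau> where "\<tau> S = (if card (V - S) \<le> n then \<sigma> S
       else let v = SOME v. v \<in> V - S in c S (insert v S) + \<sigma> (insert v S))" for S
    have "\<tau> S = c S (insert v S) + \<tau> (insert v S)"
      if S: "S \<subseteq> V" and v: "v \<in> V - S" and le: "card (V - S) \<le> Suc n" for S v
    proof -
      have small: "card (V - insert w S) \<le> n" if "w \<in> V - S" for w
        using card_less [OF that] le by linarith
      then have ins: "\<tau> (insert w S) = \<sigma> (insert w S)" if "w \<in> V - S" for w
        using that by (simp add: \<tau>_def)
      have indep: "c S (insert v S) + \<sigma> (insert v S) = c S (insert w S) + \<sigma> (insert w S)" if w: "w \<in> V - S" for w
      proof (cases "v = w")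
        case False
        let ?T = "insert w (insert v S)"
        have "\<sigma> (insert v S) = c (insert v S) ?T + \<sigma> ?T"
          using S v w False small [OF v] by (intro step) auto
        moreover have "\<sigma> (insert w S) = c (insert w S) ?T + \<sigma> ?T"
          unfolding insert_commute [of w v S] using S v w False small [OF w] by (intro step) auto
        ultimately show ?thesis using c [OF S v w False] by (metis add.assoc)
      qed simp
      have "(SOME v. v \<in> V - S) \<in> V - S" using v by (rule someI)
      then show ?thesis
        using step [OF S v] indep ins [OF v] by (auto simp: \<tau>_def [of S] Let_def)
    qed
    moreover have "\<tau> V = 0" using \<sigma> by (simp add: \<tau>_def)
    ultimately show ?case by blast
  qed
  from this [of "card V"] obtain \<sigma> where "\<sigma> V = 0"
    "\<And>S v. \<lbrakk>S \<subseteq> V; v \<in> V - S; card (V - S) \<le> card V\<rbrakk> \<Longrightarrow> \<sigma> S = c S (insert v S) + \<sigma> (insert v S)" by blast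
  moreover have "card (V - S) \<le> card V" for S using assms(1) by (intro card_mono) auto
  ultimately show ?thesis by blast
qed

text \<open>Every set is connected to \<open>V\<close> by edges of the cube, along which the potential is determined.\<close>

lemma cube_potential_unique:
  fixes \<sigma> \<tau> :: "'a set \<Rightarrow> bit"
  assumes "finite V" and top: "\<sigma> V = \<tau> V"
    and \<sigma>: "\<And>S v. \<lbrakk>S \<subseteq> V; v \<in> V - S\<rbrakk> \<Longrightarrow> \<sigma> S = c S (insert v S) + \<sigma> (insert v S)"
    and \<tau>: "\<And>S v. \<lbrakk>S \<subseteq> V; v \<in> V - S\<rbrakk> \<Longrightarrow> \<tau> S = c S (insert v S) + \<tau> (insert v S)"
    and "S \<subseteq> V"
  shows "\<sigma> S = \<tau> S"
  using \<open>S \<subseteq> V\<close>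
proof (induction "card (V - S)" arbitrary: S rule: less_induct)
  case less
  show ?case
  proof (cases "S = V")
    case False
    then obtain v where v: "v \<in> V - S" using less.prems by blast
    then have "card (V - insert v S) < card (V - S)"
      using assms(1) by (intro psubset_card_mono) auto
    then have "\<sigma> (insert v S) = \<tau> (insert v S)" using less v by blast
    then show ?thesis using \<sigma> [OF less.prems v] \<tau> [OF less.prems v] by simp
  qed (simp add: top)
qed

lemma (in cring) sign_closed [simp]: "sign R a \<in> carrier R"
  by (simp add: sign_def)

lemma (in cring) sign_zero [simp]: "sign R 0 = \<one>"
  by (simp add: sign_def)

lemma (in cring) sign_add: "sign R (a + b) = sign R a \<otimes> sign R b"
  by (cases a; cases b) (simp_all add: sign_def l_minus)

lemma (in cring) sign_add_one: "sign R (a + 1) = \<ominus> sign R a"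
  by (cases a) (simp_all add: sign_def)

text \<open>The terms for \<open>(v, w)\<close> and \<open>(w, v)\<close> cancel. The induction on \<open>A\<close> pairs them off directly;
  showing that the sum equals its own negative would not suffice when 2 is a zero divisor.\<close>

lemma (in abelian_group) finsum_antisymmetric:
  assumes "finite A" and F: "\<And>v w. \<lbrakk>v \<in> A; w \<in> A; v \<noteq> w\<rbrakk> \<Longrightarrow> F v w \<in> carrier G"
    and anti: "\<And>v w. \<lbrakk>v \<in> A; w \<in> A; v \<noteq> w\<rbrakk> \<Longrightarrow> F v w \<oplus> F w v = \<zero>"
  shows "finsum G (\<lambda>v. finsum G (F v) (A - {v})) A = \<zero>"
  using assms
proof (induction A)
  case (insert a A)
  have cl: "finsum G (F v) (B - {v}) \<in> carrier G" if "v \<in> insert a A" "B \<subseteq> insert a A" for v B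
    using that insert.prems(1) by (intro finsum_closed) blast
  have Fa: "F a v \<in> carrier G" "F v a \<in> carrier G" if "v \<in> A" for v
    using that insert by auto
  have split: "finsum G (F v) (insert a A - {v}) = F v a \<oplus> finsum G (F v) (A - {v})" if v: "v \<in> A" for v
  proof -
    have "insert a A - {v} = insert a (A - {v})" using v insert by auto
    moreover have "F v \<in> (A - {v}) \<rightarrow> carrier G" using v insert.prems(1) by auto
    ultimately show ?thesis using v insert Fa by (simp add: finsum_insert)
  qed
  have a: "insert a A - {a} = A" and FA: "finsum G (F a) A \<in> carrier G"
    using insert Fa by (auto intro: finsum_closed)
  have "finsum G (\<lambda>v. finsum G (F v) (insert a A - {v})) (insert a A) =
      finsum G (F a) A \<oplus> finsum G (\<lambda>v. finsum G (F v) (insert a A - {v})) A"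
    using insert cl [of _ "insert a A"] by (subst finsum_insert) (auto simp: a FA)
  also have "finsum G (\<lambda>v. finsum G (F v) (insert a A - {v})) A =
      finsum G (\<lambda>v. F v a \<oplus> finsum G (F v) (A - {v})) A"
    using cl [of _ A] Fa by (intro finsum_cong') (auto simp: split)
  also have "\<dots> = finsum G (\<lambda>v. F v a) A \<oplus> finsum G (\<lambda>v. finsum G (F v) (A - {v})) A"
    using cl [of _ A] Fa by (intro finsum_addf) auto
  also have "finsum G (\<lambda>v. finsum G (F v) (A - {v})) A = \<zero>"
    using insert by auto
  also have "finsum G (F a) A \<oplus> (finsum G (\<lambda>v. F v a) A \<oplus> \<zero>) = finsum G (\<lambda>v. F a v \<oplus> F v a) A"
    using Fa by (subst finsum_addf) (auto simp: finsum_closed)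
  also have "\<dots> = \<zero>"
    using insert by (intro finsum_all0) auto
  finally show ?case .
qed simp

section \<open>The bold chain complex\<close>

locale bold_complex = cring R for R (structure) +
  fixes G :: "'v pair_pre_digraph" and s :: "'v set \<Rightarrow> 'v set \<Rightarrow> bit"
  assumes graph: "pair_graph G" and sign_assignment: "sign_assignment G s"
begin

abbreviation "C i \<equiv> bold_chain R G i"
abbreviation "d i \<equiv> bold_diff R G s i"
abbreviation "e i p \<equiv> generator R (bold_gens G i) p"

lemma finite_verts: "finite (pverts G)"
  using graph by (simp add: pair_graph_def pair_digraph_def pair_fin_digraph_def pair_fin_digraph_axioms_def)

lemma finite_gens: "finite (bold_gens G i)"
  using graph by (rule finite_bold_gens)

lemma chain_module: "module R (C i)"
  unfolding bold_chain_def by (rule func_space_is_module)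

lemma e_closed [simp]: "e i p \<in> carrier (C i)"
  unfolding bold_chain_def by (rule generator_closed)

lemma gens_step:
  assumes "(S, x) \<in> bold_gens G i" "v \<in> pverts G - S"
  shows "(insert v S, component_above G (insert v S) x) \<in> bold_gens G (Suc i)"
proof -
  have "finite S" using assms finite_verts by (auto simp: bold_gens_def intro: finite_subset)
  moreover have "component_above G (insert v S) x \<in> components G (insert v S)"
    using assms by (intro component_above_mono [OF graph, of x S]) (auto simp: bold_gens_def)
  ultimately show ?thesis using assms by (auto simp: bold_gens_def)
qed

text \<open>The pairs in the definition of the differential are indexed by the flipped vertex, since the
  component of \<open>insert v S\<close> above \<open>x\<close> is unique.\<close>

lemma diff_gen:
  assumes p: "(S, x) \<in> bold_gens G i"
  shows "bold_diff_gen R G s i (S, x) =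
    finsum (C (Suc i)) (\<lambda>v. sign R (s S (insert v S)) \<odot>\<^bsub>C (Suc i)\<^esub>
       e (Suc i) (insert v S, component_above G (insert v S) x)) (pverts G - S)"
proof -
  interpret C: module R "C (Suc i)" by (rule chain_module)
  let ?h = "\<lambda>v. (insert v S, component_above G (insert v S) x)"
  from p have S: "S \<subseteq> pverts G" and x: "x \<in> components G S" by (auto simp: bold_gens_def)
  have "{(T, y). flip G S T \<and> y \<in> components G T \<and> x \<subseteq> y} = ?h ` (pverts G - S)" (is "?A = ?B")
  proof (intro equalityI subsetI)
    fix p assume "p \<in> ?A"
    then obtain T y v where "p = (T, y)" "v \<in> pverts G - S" "T = insert v S" "y \<in> components G T" "x \<subseteq> y"
      by (auto simp: flip_def)
    moreover from this have "component_above G T x = y"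
      using components_nonempty [OF x] by (intro component_above_eq graph)
    ultimately show "p \<in> ?B" by auto
  next
    fix p assume "p \<in> ?B"
    then obtain v where v: "v \<in> pverts G - S" "p = ?h v" by blast
    then show "p \<in> ?A"
      using S component_above_mono [OF graph x, of "insert v S"] by (auto simp: flip_def)
  qed
  have "finsum (C (Suc i)) g (?h ` (pverts G - S)) = finsum (C (Suc i)) (\<lambda>v. g (?h v)) (pverts G - S)"
    if "\<And>p. g p \<in> carrier (C (Suc i))" for g
    using that by (intro C.M.finsum_reindex) (auto simp: inj_on_def)
  from this [of "\<lambda>(T, y). sign R (s S T) \<odot>\<^bsub>C (Suc i)\<^esub> e (Suc i) (T, y)"] \<open>?A = ?B\<close>
  show ?thesis
    unfolding bold_diff_gen_def prod.case by (simp add: split_beta)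
qed

lemma diff_gen_closed: "bold_diff_gen R G s i \<in> bold_gens G i \<rightarrow> carrier (C (Suc i))"
proof
  fix p assume p: "p \<in> bold_gens G i"
  obtain S x where Sx: "p = (S, x)" by (cases p)
  interpret C: module R "C (Suc i)" by (rule chain_module)
  show "bold_diff_gen R G s i p \<in> carrier (C (Suc i))"
    unfolding Sx diff_gen [OF p [unfolded Sx]] by (intro C.M.finsum_closed) auto
qed

lemma diff_hom: "mod_hom R (C i) (C (Suc i)) (d i)"
proof -
  interpret C: module R "C (Suc i)" by (rule chain_module)
  show ?thesis unfolding bold_diff_def
    using C.linear_extension_hom [OF finite_gens diff_gen_closed]
    by (simp add: bold_chain_def [of R G i])
qed

lemma diff_e:
  assumes "(S, x) \<in> bold_gens G i"
  shows "d i (e i (S, x)) =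
    finsum (C (Suc i)) (\<lambda>v. sign R (s S (insert v S)) \<odot>\<^bsub>C (Suc i)\<^esub>
       e (Suc i) (insert v S, component_above G (insert v S) x)) (pverts G - S)"
proof -
  interpret C: module R "C (Suc i)" by (rule chain_module)
  show ?thesis unfolding bold_diff_def
    by (simp add: C.linear_extension_generator [OF finite_gens diff_gen_closed assms] diff_gen [OF assms])
qed

text \<open>Functoriality of components on the cube.\<close>

lemma component_above_twice:
  assumes "(S, x) \<in> bold_gens G i" "S \<subseteq> T" "T \<subseteq> U"
  shows "component_above G U (component_above G T x) = component_above G U x"
proof -
  have x: "x \<in> components G S" using assms by (auto simp: bold_gens_def)
  note T = component_above_mono [OF graph x assms(2)]
  show ?thesis
    using component_above_mono [OF graph T(1) assms(3)] T components_nonempty [OF x]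
    by (intro component_above_eq [OF graph, symmetric]) auto
qed

lemma sign_square:
  assumes "S \<subseteq> pverts G" "v \<in> pverts G - S" "w \<in> pverts G - S" "v \<noteq> w"
  shows "s S (insert v S) + s (insert v S) (insert w (insert v S)) =
    s S (insert w S) + s (insert w S) (insert v (insert w S)) + 1"
proof -
  have "flip G S (insert v S)" "flip G S (insert w S)"
     "flip G (insert v S) (insert w (insert v S))" "flip G (insert w S) (insert w (insert v S))"
    using assms unfolding flip_def by (auto intro: bexI [of _ w] bexI [of _ v])
  moreover have "insert v S \<noteq> insert w S" using assms by auto
  ultimately show ?thesis
    using sign_assignment unfolding sign_assignment_def insert_commute [of v w S] by metis
qed

text \<open>The coefficient sum runs over ordered pairs of distinct vertices outside \<open>S\<close>. By functoriality
  of components, the two orders reach the same generator, and the sign assignment makes their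
  coefficients opposite.\<close>

lemma diff_diff_e:
  assumes p: "(S, x) \<in> bold_gens G i"
  shows "d (Suc i) (d i (e i (S, x))) = \<zero>\<^bsub>C (Suc (Suc i))\<^esub>"
proof -
  interpret C1: module R "C (Suc i)" by (rule chain_module)
  interpret C: module R "C (Suc (Suc i))" by (rule chain_module)
  interpret d: mod_hom R "C (Suc i)" "C (Suc (Suc i))" "d (Suc i)" by (rule diff_hom)
  let ?T = "\<lambda>v w. insert w (insert v S)"
  define F where "F v w = sign R (s S (insert v S) + s (insert v S) (?T v w)) \<odot>\<^bsub>C (Suc (Suc i))\<^esub>
     e (Suc (Suc i)) (?T v w, component_above G (?T v w) x)" for v w
  have F: "F v w \<in> carrier (C (Suc (Suc i)))" for v w unfolding F_def by simp
  have S: "S \<subseteq> pverts G" using p by (simp add: bold_gens_def)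
  have inner: "d (Suc i) (sign R (s S (insert v S)) \<odot>\<^bsub>C (Suc i)\<^esub>
       e (Suc i) (insert v S, component_above G (insert v S) x)) =
       finsum (C (Suc (Suc i))) (F v) (pverts G - S - {v})" if v: "v \<in> pverts G - S" for v
  proof -
    have V: "pverts G - insert v S = pverts G - S - {v}" by auto
    have twice: "component_above G (?T v w) (component_above G (insert v S) x) = component_above G (?T v w) x" for w
      by (rule component_above_twice [OF p]) auto
    have "d (Suc i) (sign R (s S (insert v S)) \<odot>\<^bsub>C (Suc i)\<^esub>
       e (Suc i) (insert v S, component_above G (insert v S) x)) =
       sign R (s S (insert v S)) \<odot>\<^bsub>C (Suc (Suc i))\<^esub>
       finsum (C (Suc (Suc i))) (\<lambda>w. sign R (s (insert v S) (?T v w)) \<odot>\<^bsub>C (Suc (Suc i))\<^esub>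
       e (Suc (Suc i)) (?T v w, component_above G (?T v w) (component_above G (insert v S) x))) (pverts G - S - {v})"
      by (simp add: diff_e [OF gens_step [OF p v]] V)
    also have "\<dots> = finsum (C (Suc (Suc i))) (\<lambda>w. sign R (s S (insert v S)) \<odot>\<^bsub>C (Suc (Suc i))\<^esub>
       (sign R (s (insert v S) (?T v w)) \<odot>\<^bsub>C (Suc (Suc i))\<^esub>
       e (Suc (Suc i)) (?T v w, component_above G (?T v w) (component_above G (insert v S) x)))) (pverts G - S - {v})"
      by (intro C.finsum_smult) auto
    also have "\<dots> = finsum (C (Suc (Suc i))) (F v) (pverts G - S - {v})"
      by (intro C.M.finsum_cong')
         (auto simp: F F_def sign_add C.smult_assoc1 twice simp del: add_bit_eq_xor)
    finally show ?thesis .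
  qed
  have "d (Suc i) (d i (e i (S, x))) =
      finsum (C (Suc (Suc i))) (\<lambda>v. finsum (C (Suc (Suc i))) (F v) (pverts G - S - {v})) (pverts G - S)"
    unfolding diff_e [OF p]
    by (subst d.hom_finsum) (auto intro!: C.M.finsum_cong' C.M.finsum_closed simp: inner F simp del: d.f_smult)
  also have "\<dots> = \<zero>\<^bsub>C (Suc (Suc i))\<^esub>"
  proof (rule C.M.finsum_antisymmetric)
    show "finite (pverts G - S)" using finite_verts by simp
    fix v w assume vw: "v \<in> pverts G - S" "w \<in> pverts G - S" "v \<noteq> w"
    show "F v w \<in> carrier (C (Suc (Suc i)))" by (rule F)
    \<comment> \<open>The square spanned by \<open>v\<close> and \<open>w\<close> contributes the extra 1 to the exponent.\<close>
    have "F v w = (\<ominus> \<one>) \<odot>\<^bsub>C (Suc (Suc i))\<^esub> F w v"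
      unfolding F_def sign_square [OF S vw] sign_add_one insert_commute [of v w S]
      by (simp add: C.smult_assoc1 [symmetric] l_minus del: add_bit_eq_xor)
    then show "F v w \<oplus>\<^bsub>C (Suc (Suc i))\<^esub> F w v = \<zero>\<^bsub>C (Suc (Suc i))\<^esub>"
      using F by (simp add: C.smult_minus_1 C.M.l_neg)
  qed
  finally show ?thesis .
qed

lemma zero_hom: "mod_hom R (C i) (C j) (\<lambda>_. \<zero>\<^bsub>C j\<^esub>)"
proof -
  interpret C: module R "C j" by (rule chain_module)
  show ?thesis
    by (intro mod_hom.intro mod_hom_axioms.intro chain_module) (auto simp: module_hom_def)
qed

lemma chain_hom_ext:
  assumes "mod_hom R (C i) N f" "mod_hom R (C i) N g"
    and "\<And>S x. (S, x) \<in> bold_gens G i \<Longrightarrow> f (e i (S, x)) = g (e i (S, x))"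
    and "c \<in> carrier (C i)"
  shows "f c = g c"
  using assms unfolding bold_chain_def
  by (intro func_space_hom_ext [of R "bold_gens G i" N f g c] finite_gens) auto

lemma diff_diff: "c \<in> carrier (C i) \<Longrightarrow> d (Suc i) (d i c) = \<zero>\<^bsub>C (Suc (Suc i))\<^esub>"
  using chain_hom_ext [OF mod_hom_comp [OF diff_hom diff_hom] zero_hom, of i c] diff_diff_e by simp

lemma cycles_eq: "bold_cycles R G s i = {c \<in> carrier (C i). d i c = \<zero>\<^bsub>C (Suc i)\<^esub>}"
  unfolding bold_cycles_def by (rule mod_hom.ker_def [OF diff_hom])

lemma boundaries_Suc: "bold_boundaries R G s (Suc i) = d i ` carrier (C i)"
  using mod_hom.im_def [OF diff_hom] by simp

lemma cycles_submodule: "submodule R (bold_cycles R G s i) (C i)"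
  unfolding bold_cycles_def by (rule mod_hom.ker_is_submodule [OF diff_hom])

lemma boundaries_submodule: "submodule R (bold_boundaries R G s i) (C i)"
proof (cases i)
  case 0
  interpret C: module R "C 0" by (rule chain_module)
  show ?thesis unfolding 0 by (intro submodule.intro C.module_axioms) auto
next
  case (Suc j)
  then show ?thesis using mod_hom.im_is_submodule [OF diff_hom] by simp
qed

lemma boundaries_subset_cycles: "bold_boundaries R G s i \<subseteq> bold_cycles R G s i"
proof (cases i)
  case 0
  interpret Z: submodule R "bold_cycles R G s 0" "C 0" by (rule cycles_submodule)
  show ?thesis unfolding 0 by simp
next
  case (Suc j)
  then show ?thesis
    using mod_hom.f_im [OF diff_hom] diff_diff by (auto simp: cycles_eq boundaries_Suc simp del: bold_boundaries.simps)
qed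

lemma homology_module: "module R (bold_homology R G s i)"
proof -
  interpret C: module R "C i" by (rule chain_module)
  interpret Z: module R "C i\<lparr>carrier := bold_cycles R G s i\<rparr>"
    by (rule C.submodule_is_module [OF cycles_submodule])
  have "mod_hom R (C i\<lparr>carrier := bold_cycles R G s i\<rparr>) (bold_homology R G s i)
     (\<lambda>x. bold_boundaries R G s i +>\<^bsub>C i\<lparr>carrier := bold_cycles R G s i\<rparr>\<^esub> x)"
    unfolding bold_homology_def
    by (intro Z.quotient_module_hom C.submodule_trans cycles_submodule boundaries_submodule boundaries_subset_cycles)
  then show ?thesis by (simp add: mod_hom_def)
qed

lemma homology_carrier:
  "carrier (bold_homology R G s i) = {bold_boundaries R G s i +>\<^bsub>C i\<^esub> z | z. z \<in> bold_cycles R G s i}"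
  by (simp add: bold_homology_def quotient_carrier)

lemma cycles_carrier: "z \<in> bold_cycles R G s i \<Longrightarrow> z \<in> carrier (C i)"
  by (simp add: cycles_eq)

end

section \<open>The Euler characteristic of bold homology\<close>

lemma bold_euler_eq:
  assumes "field K" and G: "pair_graph G" and s: "sign_assignment G s"
  shows "bold_euler K G s = poly (conn_dom_poly G) (-1)"
proof -
  interpret field K by fact
  interpret bold_complex K G s
    by (intro bold_complex.intro bold_complex_axioms.intro cring_axioms G s)
  let ?n = "card (pverts G)"
  have "carrier (C (Suc ?n)) = {\<zero>\<^bsub>C (Suc ?n)\<^esub>}"
    unfolding bold_chain_def bold_gens_above_top [OF G] by (simp add: func_space_carrier func_space_zero restrict_def)
  then have "bold_euler K G s = (\<Sum>i\<le>?n. (-1) ^ i * int (vectorspace.dim K (C i)))"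
    unfolding bold_euler_def bold_homology_def bold_cycles_def
    using dim_func_space(1) [OF finite_gens]
    by (intro euler_poincare \<open>field K\<close> diff_hom diff_diff) (auto simp: bold_chain_def)
  also have "\<dots> = (\<Sum>i\<le>?n. (-1) ^ i * int (card (bold_gens G i)))"
    using dim_func_space(2) [OF finite_gens] by (simp add: bold_chain_def)
  also have "\<dots> = poly (conn_dom_poly G) (-1)" using G by (rule euler_bold_gens)
  finally show ?thesis .
qed

section \<open>Maps induced by injective morphisms\<close>

lemma extend_colouring_insert: "extend_colouring G H f (insert v S) = insert (f v) (extend_colouring G H f S)"
  by (auto simp: extend_colouring_def)

lemma extend_colouring_subset:
  "inj_morphism G H f \<Longrightarrow> S \<subseteq> pverts G \<Longrightarrow> extend_colouring G H f S \<subseteq> pverts H"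
  by (auto simp: extend_colouring_def inj_morphism_def)

lemma extend_colouring_top: "inj_morphism G H f \<Longrightarrow> extend_colouring G H f (pverts G) = pverts H"
  by (auto simp: extend_colouring_def inj_morphism_def)

text \<open>The vertices that can still be flipped correspond under \<open>f\<close>, because the vertices outside the
  image of \<open>f\<close> already have colour 1.\<close>

lemma extend_colouring_compl:
  assumes f: "inj_morphism G H f" and S: "S \<subseteq> pverts G"
  shows "pverts H - extend_colouring G H f S = f ` (pverts G - S)"
proof -
  have "f ` (pverts G - S) = f ` pverts G - f ` S"
    using f S by (intro inj_on_image_set_diff [of f "pverts G"]) (auto simp: inj_morphism_def)
  moreover have "f ` pverts G \<subseteq> pverts H" using f by (simp add: inj_morphism_def)
  ultimately show ?thesis by (auto simp: extend_colouring_def)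
qed

lemma extend_colouring_notin:
  "inj_morphism G H f \<Longrightarrow> S \<subseteq> pverts G \<Longrightarrow> v \<in> pverts G - S \<Longrightarrow> f v \<in> pverts H - extend_colouring G H f S"
  by (simp only: extend_colouring_compl) (rule imageI)

lemma extend_colouring_comp:
  assumes f: "inj_morphism G H f" and g: "inj_morphism H J g" and S: "S \<subseteq> pverts G"
  shows "extend_colouring G J (g \<circ> f) S = extend_colouring H J g (extend_colouring G H f S)"
proof -
  have "g ` (pverts H - f ` pverts G) = g ` pverts H - g ` f ` pverts G"
    using f g by (intro inj_on_image_set_diff [of g "pverts H"]) (auto simp: inj_morphism_def)
  moreover have "g ` f ` pverts G \<subseteq> g ` pverts H" "g ` pverts H \<subseteq> pverts J"
    using f g by (auto simp: inj_morphism_def)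
  ultimately show ?thesis by (auto simp: extend_colouring_def image_comp image_Un)
qed

lemma inj_morphism_comp:
  assumes f: "inj_morphism G H f" and g: "inj_morphism H J g"
  shows "inj_morphism G J (g \<circ> f)"
proof -
  have "inj_on (g \<circ> f) (pverts G)"
    using f g by (intro comp_inj_on) (auto simp: inj_morphism_def intro: inj_on_subset)
  moreover have "(g \<circ> f) ` pverts G \<subseteq> pverts J"
    using f g unfolding inj_morphism_def by (auto simp: image_subset_iff)
  moreover have "((g \<circ> f) u, (g \<circ> f) v) \<in> parcs J" if "(u, v) \<in> parcs G" for u v
    using f g that unfolding inj_morphism_def by fastforce
  ultimately show ?thesis unfolding inj_morphism_def by blast
qed

lemma card_le_inj_morphism:
  assumes "finite (pverts H)" "inj_morphism G H f"
  shows "card (pverts G) \<le> card (pverts H)"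
  using assms by (intro card_inj_on_le [of f]) (simp_all add: inj_morphism_def)

locale bold_morphism = dom: bold_complex R G s + cod: bold_complex R H t
  for R (structure) and G :: "'v pair_pre_digraph" and s and H :: "'w pair_pre_digraph" and t +
  fixes f :: "'v \<Rightarrow> 'w"
  assumes morphism: "inj_morphism G H f"
begin

abbreviation "ext S \<equiv> extend_colouring G H f S"
abbreviation "\<sigma> \<equiv> correction_sign G s H t f"
abbreviation "k \<equiv> degree_shift G H"
abbreviation "\<phi> i \<equiv> bold_chain_map R G s H t f i"

text \<open>The conditions on the correction sign other than extensionality: solutions have to be compared
  only on subsets of the vertex set, and natural candidates are not extensional.\<close>

definition correction_law :: "('v set \<Rightarrow> bit) \<Rightarrow> bool" where
  "correction_law \<tau> \<longleftrightarrow> \<tau> (pverts G) = 0 \<and>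
     (\<forall>S T. flip G S T \<longrightarrow> s S T + \<tau> T = \<tau> S + t (ext S) (ext T))"

text \<open>Modulo 2, the equations say that the correction sign is a potential for the difference of the
  two sign assignments along the face of the cube of \<open>H\<close> on which \<open>f\<close> acts.\<close>

lemma correction_law_iff:
  "correction_law \<tau> \<longleftrightarrow> \<tau> (pverts G) = 0 \<and>
     (\<forall>S v. S \<subseteq> pverts G \<and> v \<in> pverts G - S \<longrightarrow>
        \<tau> S = (s S (insert v S) + t (ext S) (ext (insert v S))) + \<tau> (insert v S))"
proof -
  have bits: "a + b = c + e \<longleftrightarrow> c = (a + e) + b" for a b c e :: bit
    by (cases a; cases b; cases c; cases e) simp_all
  have flips: "(\<forall>S T. flip G S T \<longrightarrow> P S T) \<longleftrightarrow> (\<forall>S v. S \<subseteq> pverts G \<and> v \<in> pverts G - S \<longrightarrow> P S (insert v S))" for P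
    by (auto simp: flip_def)
  show ?thesis unfolding correction_law_def flips bits ..
qed

lemma correction_law_unique:
  assumes "correction_law \<tau>" "correction_law \<tau>'" "S \<subseteq> pverts G"
  shows "\<tau> S = \<tau>' S"
proof (rule cube_potential_unique [where c = "\<lambda>S T. s S T + t (ext S) (ext T)"])
  show "finite (pverts G)" by (rule dom.finite_verts)
  show "S \<subseteq> pverts G" by fact
qed (use assms(1,2) correction_law_iff in auto)

text \<open>Around a square, each of the sign assignments contributes 1, and the two contributions cancel.\<close>

lemma correction_law_exists: "\<exists>\<tau>. correction_law \<tau>"
proof -
  have "\<exists>\<tau>. \<tau> (pverts G) = 0 \<and> (\<forall>S v. S \<subseteq> pverts G \<and> v \<in> pverts G - S \<longrightarrow>
      \<tau> S = (s S (insert v S) + t (ext S) (ext (insert v S))) + \<tau> (insert v S))"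
  proof (rule cube_cocycle_is_coboundary [where c = "\<lambda>S T. s S T + t (ext S) (ext T)"])
    show "finite (pverts G)" by (rule dom.finite_verts)
    fix S v w assume S: "S \<subseteq> pverts G" and v: "v \<in> pverts G - S" and w: "w \<in> pverts G - S" and vw: "v \<noteq> w"
    have fvw: "f v \<noteq> f w" using morphism v w vw by (auto simp: inj_morphism_def inj_on_def)
    note 1 = dom.sign_square [OF S v w vw, unfolded insert_commute [of v w S]]
    note 2 = cod.sign_square [OF extend_colouring_subset [OF morphism S]
        extend_colouring_notin [OF morphism S v] extend_colouring_notin [OF morphism S w] fvw, unfolded insert_commute [of "f v" "f w" "ext S"]]
    have bits: "(a + a') + (b + b') = (c + c') + (e + e')"
      if "a + b = c + e + 1" "a' + b' = c' + e' + 1" for a b c e a' b' c' e' :: bit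
    proof -
      have "(a + a') + (b + b') = (a + b) + (a' + b')" by (simp only: ac_simps)
      also have "\<dots> = (c + c') + (e + e') + (1 + 1)" unfolding that by (simp only: ac_simps)
      finally show ?thesis by simp
    qed
    show "s S (insert v S) + t (ext S) (ext (insert v S)) +
       (s (insert v S) (insert w (insert v S)) + t (ext (insert v S)) (ext (insert w (insert v S)))) =
       s S (insert w S) + t (ext S) (ext (insert w S)) +
       (s (insert w S) (insert w (insert v S)) + t (ext (insert w S)) (ext (insert w (insert v S))))"
      unfolding extend_colouring_insert by (rule bits [OF 1 2])
  qed
  then show ?thesis unfolding correction_law_iff .
qed

text \<open>The definite description in the definition of the correction sign is proper: restricting a solution
  to the subsets of the vertex set makes it extensional without affecting the equations.\<close>

lemma correction_law_correction_sign: "correction_law \<sigma>"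
proof -
  obtain \<tau> where \<tau>: "correction_law \<tau>" using correction_law_exists by blast
  let ?\<tau> = "restrict \<tau> (Pow (pverts G))"
  have cong: "correction_law \<rho>" if "correction_law \<rho>'" "\<And>S. S \<subseteq> pverts G \<Longrightarrow> \<rho> S = \<rho>' S" for \<rho> \<rho>'
    using that unfolding correction_law_def flip_def by (metis DiffD1 insert_subset order_refl)
  have law: "correction_law ?\<tau>" using \<tau> by (rule cong) simp
  have "\<sigma> = (THE \<tau>. \<tau> \<in> extensional (Pow (pverts G)) \<and> correction_law \<tau>)"
    by (simp add: correction_sign_def correction_law_def)
  also have "\<dots> = ?\<tau>"
  proof (rule the_equality)
    fix \<rho> assume \<rho>: "\<rho> \<in> extensional (Pow (pverts G)) \<and> correction_law \<rho>"
    then show "\<rho> = ?\<tau>"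
      using correction_law_unique [OF _ law] by (intro extensionalityI [of _ "Pow (pverts G)"]) auto
  qed (use law in simp)
  finally show ?thesis using law by simp
qed

lemma correction_sign_eq: "correction_law \<tau> \<Longrightarrow> S \<subseteq> pverts G \<Longrightarrow> \<sigma> S = \<tau> S"
  using correction_law_correction_sign by (rule correction_law_unique)

lemma correction_sign_top: "\<sigma> (pverts G) = 0"
  using correction_law_correction_sign by (simp add: correction_law_def)

lemma correction_sign_flip:
  "flip G S T \<Longrightarrow> s S T + \<sigma> T = \<sigma> S + t (ext S) (ext T)"
  using correction_law_correction_sign by (simp add: correction_law_def)

lemma card_ext:
  assumes "S \<subseteq> pverts G"
  shows "card (ext S) = card S + k"
proof -
  have "card (ext S) = card (f ` S) + card (pverts H - f ` pverts G)"
    unfolding extend_colouring_def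
    using assms dom.finite_verts cod.finite_verts
    by (intro card_Un_disjoint) (auto intro: finite_subset)
  also have "card (f ` S) = card S"
    using assms morphism by (intro card_image) (auto simp: inj_morphism_def intro: inj_on_subset)
  also have "card (pverts H - f ` pverts G) = card (pverts H) - card (f ` pverts G)"
    using morphism dom.finite_verts by (intro card_Diff_subset) (auto simp: inj_morphism_def)
  also have "card (f ` pverts G) = card (pverts G)"
    using morphism by (intro card_image) (auto simp: inj_morphism_def)
  finally show ?thesis by (simp add: degree_shift_def)
qed

lemma ext_component:
  assumes "(S, x) \<in> bold_gens G i"
  shows "component_above H (ext S) (f ` x) \<in> components H (ext S)"
    "f ` x \<subseteq> component_above H (ext S) (f ` x)"
proof -
  have "x \<in> components G S" "f ` S \<subseteq> ext S" using assms by (auto simp: bold_gens_def extend_colouring_def)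
  from component_above_image [OF cod.graph morphism this]
  show "component_above H (ext S) (f ` x) \<in> components H (ext S)"
    "f ` x \<subseteq> component_above H (ext S) (f ` x)" .
qed

lemma ext_gens:
  assumes "(S, x) \<in> bold_gens G i"
  shows "(ext S, component_above H (ext S) (f ` x)) \<in> bold_gens H (i + k)"
  using assms ext_component [OF assms] card_ext extend_colouring_subset [OF morphism]
  by (auto simp: bold_gens_def)

lemma chain_map_unfold:
  "\<phi> i = linear_extension (bold_gens G i) (cod.C (i + k))
     (\<lambda>(S, x). sign R (\<sigma> S) \<odot>\<^bsub>cod.C (i + k)\<^esub> cod.e (i + k) (ext S, component_above H (ext S) (f ` x)))"
  by (simp add: bold_chain_map_def component_above_def Let_def)

lemma chain_map_hom: "mod_hom R (dom.C i) (cod.C (i + k)) (\<phi> i)"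
proof -
  interpret C: module R "cod.C (i + k)" by (rule cod.chain_module)
  show ?thesis
    unfolding chain_map_unfold bold_chain_def [of R G i]
    by (rule C.linear_extension_hom [OF dom.finite_gens]) auto
qed

lemma chain_map_e:
  assumes "(S, x) \<in> bold_gens G i"
  shows "\<phi> i (dom.e i (S, x)) =
    sign R (\<sigma> S) \<odot>\<^bsub>cod.C (i + k)\<^esub> cod.e (i + k) (ext S, component_above H (ext S) (f ` x))"
proof -
  interpret C: module R "cod.C (i + k)" by (rule cod.chain_module)
  show ?thesis
    unfolding chain_map_unfold
    by (subst C.linear_extension_generator [OF dom.finite_gens _ assms]) auto
qed

text \<open>Both sides are sums over the vertices \<open>v\<close> outside \<open>S\<close>, where flipping \<open>v\<close> corresponds to
  flipping \<open>f v\<close>. The components agree because both contain the image of \<open>x\<close>, and the signs agree by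
  the equation for the correction sign at the edge from \<open>S\<close> to \<open>insert v S\<close>.\<close>

lemma chain_map_diff_e:
  assumes p: "(S, x) \<in> bold_gens G i"
  shows "\<phi> (Suc i) (dom.d i (dom.e i (S, x))) = cod.d (i + k) (\<phi> i (dom.e i (S, x)))"
proof -
  let ?D = "cod.C (Suc (i + k))"
  interpret D: module R ?D by (rule cod.chain_module)
  interpret d: mod_hom R "cod.C (i + k)" ?D "cod.d (i + k)" by (rule cod.diff_hom)
  interpret C1: module R "dom.C (Suc i)" by (rule dom.chain_module)
  interpret phi: mod_hom R "dom.C (Suc i)" ?D "\<phi> (Suc i)" using chain_map_hom [of "Suc i"] by simp
  let ?y = "component_above H (ext S) (f ` x)"
  from p have S: "S \<subseteq> pverts G" and x: "x \<in> components G S" by (auto simp: bold_gens_def)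
  \<comment> \<open>The common summand of both sides.\<close>
  define F where "F v = sign R (s S (insert v S) + \<sigma> (insert v S)) \<odot>\<^bsub>?D\<^esub>
     cod.e (Suc (i + k)) (ext (insert v S), component_above H (ext (insert v S)) (f ` x))" for v
  have F: "F v \<in> carrier ?D" for v by (simp add: F_def)
  \<comment> \<open>Any linked set that contains the image of \<open>x\<close> lies below the same component.\<close>
  have up: "component_above H (ext (insert v S)) z = component_above H (ext (insert v S)) (f ` x)"
    if v: "v \<in> pverts G - S" and z: "f ` x \<subseteq> z" "\<And>a b. a \<in> z \<Longrightarrow> b \<in> z \<Longrightarrow> linked H (ext (insert v S)) a b" for v z
  proof -
    have "z \<noteq> {}" using z(1) components_nonempty [OF x] by blast
    note c = component_above [OF cod.graph this z(2)]
    show ?thesis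
      using c z(1) components_nonempty [OF x] by (intro component_above_eq [OF cod.graph, symmetric]) auto
  qed
  have left: "\<phi> (Suc i) (sign R (s S (insert v S)) \<odot>\<^bsub>dom.C (Suc i)\<^esub>
      dom.e (Suc i) (insert v S, component_above G (insert v S) x)) = F v" if v: "v \<in> pverts G - S" for v
  proof -
    note g = dom.gens_step [OF p v]
    have "x \<subseteq> component_above G (insert v S) x"
      using component_above_mono [OF dom.graph x, of "insert v S"] by auto
    then have "f ` x \<subseteq> f ` component_above G (insert v S) x" by (rule image_mono)
    moreover have "linked H (ext (insert v S)) a b"
      if "a \<in> f ` component_above G (insert v S) x" "b \<in> f ` component_above G (insert v S) x" for a b
      using that ext_component(2) [OF g] by (intro components_linked [OF ext_component(1) [OF g]]) auto
    ultimately have "component_above H (ext (insert v S)) (f ` component_above G (insert v S) x) =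
        component_above H (ext (insert v S)) (f ` x)"
      by (rule up [OF v])
    then show ?thesis
      by (simp add: chain_map_e [OF g, simplified] F_def dom.sign_add D.smult_assoc1 del: add_bit_eq_xor)
  qed
  have right: "sign R (\<sigma> S) \<odot>\<^bsub>?D\<^esub> (sign R (t (ext S) (insert (f v) (ext S))) \<odot>\<^bsub>?D\<^esub>
      cod.e (Suc (i + k)) (insert (f v) (ext S), component_above H (insert (f v) (ext S)) ?y)) = F v"
    if v: "v \<in> pverts G - S" for v
  proof -
    have "linked H (ext (insert v S)) a b" if "a \<in> ?y" "b \<in> ?y" for a b
      using components_linked [OF ext_component(1) [OF p] that]
      by (rule linked_mono) (auto simp: extend_colouring_insert)
    from up [OF v ext_component(2) [OF p] this]
    have "component_above H (ext (insert v S)) ?y = component_above H (ext (insert v S)) (f ` x)" .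
    moreover have "flip G S (insert v S)" using S v by (auto simp: flip_def)
    ultimately show ?thesis
      by (simp add: F_def correction_sign_flip dom.sign_add D.smult_assoc1 extend_colouring_insert del: add_bit_eq_xor)
  qed
  have "\<phi> (Suc i) (dom.d i (dom.e i (S, x))) = finsum ?D F (pverts G - S)"
    unfolding dom.diff_e [OF p]
    by (subst phi.hom_finsum) (auto intro!: D.M.finsum_cong' simp: left F simp del: phi.f_smult)
  also have "\<dots> = finsum ?D (\<lambda>v. sign R (\<sigma> S) \<odot>\<^bsub>?D\<^esub> (sign R (t (ext S) (insert (f v) (ext S))) \<odot>\<^bsub>?D\<^esub>
      cod.e (Suc (i + k)) (insert (f v) (ext S), component_above H (insert (f v) (ext S)) ?y))) (pverts G - S)"
    by (intro D.M.finsum_cong') (auto simp: right)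
  also have "\<dots> = sign R (\<sigma> S) \<odot>\<^bsub>?D\<^esub> finsum ?D (\<lambda>v. sign R (t (ext S) (insert (f v) (ext S))) \<odot>\<^bsub>?D\<^esub>
      cod.e (Suc (i + k)) (insert (f v) (ext S), component_above H (insert (f v) (ext S)) ?y)) (pverts G - S)"
    by (intro D.finsum_smult [symmetric]) auto
  also have "finsum ?D (\<lambda>v. sign R (t (ext S) (insert (f v) (ext S))) \<odot>\<^bsub>?D\<^esub>
      cod.e (Suc (i + k)) (insert (f v) (ext S), component_above H (insert (f v) (ext S)) ?y)) (pverts G - S) =
      finsum ?D (\<lambda>w. sign R (t (ext S) (insert w (ext S))) \<odot>\<^bsub>?D\<^esub>
      cod.e (Suc (i + k)) (insert w (ext S), component_above H (insert w (ext S)) ?y)) (f ` (pverts G - S))"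
    using morphism by (intro D.M.finsum_reindex [symmetric]) (auto simp: inj_morphism_def intro: inj_on_subset)
  also have "f ` (pverts G - S) = pverts H - ext S"
    using extend_colouring_compl [OF morphism S] by simp
  also have "sign R (\<sigma> S) \<odot>\<^bsub>?D\<^esub> finsum ?D (\<lambda>w. sign R (t (ext S) (insert w (ext S))) \<odot>\<^bsub>?D\<^esub>
      cod.e (Suc (i + k)) (insert w (ext S), component_above H (insert w (ext S)) ?y)) (pverts H - ext S) =
      cod.d (i + k) (\<phi> i (dom.e i (S, x)))"
    by (simp add: chain_map_e [OF p] cod.diff_e [OF ext_gens [OF p]])
  finally show ?thesis .
qed

lemma chain_map_diff:
  assumes "c \<in> carrier (dom.C i)"
  shows "\<phi> (Suc i) (dom.d i c) = cod.d (i + k) (\<phi> i c)"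
proof -
  have "mod_hom R (dom.C i) (cod.C (Suc (i + k))) (\<phi> (Suc i) \<circ> dom.d i)"
    using mod_hom_comp [OF dom.diff_hom chain_map_hom, of i] by simp
  from dom.chain_hom_ext [OF this mod_hom_comp [OF chain_map_hom cod.diff_hom] _ assms]
  show ?thesis using chain_map_diff_e by simp
qed

lemma chain_map_cycles: "\<phi> i ` bold_cycles R G s i \<subseteq> bold_cycles R H t (i + k)"
  using chain_map_diff mod_hom.f_im [OF chain_map_hom] mod_hom.f0_is_0 [OF chain_map_hom, of "Suc i"]
  by (auto simp: dom.cycles_eq cod.cycles_eq dest: sym)

lemma chain_map_boundaries: "\<phi> i ` bold_boundaries R G s i \<subseteq> bold_boundaries R H t (i + k)"
proof (cases i)
  case 0
  interpret B: submodule R "bold_boundaries R H t (0 + k)" "cod.C (0 + k)" by (rule cod.boundaries_submodule)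
  show ?thesis using mod_hom.f0_is_0 [OF chain_map_hom, of 0] B.zero_closed unfolding 0 by simp
next
  case (Suc j)
  show ?thesis
    using chain_map_diff [of _ j] mod_hom.f_im [OF chain_map_hom, of _ j]
    by (auto simp: Suc dom.boundaries_Suc cod.boundaries_Suc simp del: bold_boundaries.simps)
qed

lemma bold_map_coset:
  assumes "z \<in> carrier (dom.C i)"
  shows "bold_map R G s H t f i (bold_boundaries R G s i +>\<^bsub>dom.C i\<^esub> z) =
    bold_boundaries R H t (i + k) +>\<^bsub>cod.C (i + k)\<^esub> \<phi> i z"
  unfolding bold_map_def Let_def
  by (rule mod_hom.Union_cosets [OF chain_map_hom dom.boundaries_submodule cod.boundaries_submodule chain_map_boundaries assms])

lemma bold_map_hom:
  "bold_map R G s H t f i \<in> module_hom R (bold_homology R G s i) (bold_homology R H t (i + k))"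
  using mod_hom.induced_hom [OF chain_map_hom dom.cycles_submodule dom.boundaries_submodule
      dom.boundaries_subset_cycles cod.cycles_submodule cod.boundaries_submodule
      cod.boundaries_subset_cycles chain_map_cycles chain_map_boundaries]
  by (simp add: bold_homology_def bold_map_def [abs_def] Let_def)

end

text \<open>The zero function solves the equations for the correction sign of the identity.\<close>

lemma (in bold_complex) bold_map_id:
  assumes "X \<in> carrier (bold_homology R G s i)"
  shows "bold_map R G s G s id i X = X"
proof -
  interpret id: bold_morphism R G s G s id
    by unfold_locales (auto simp: inj_morphism_def)
  interpret C: module R "C i" by (rule chain_module)
  have k: "degree_shift G G = 0" by (simp add: degree_shift_def)
  have ext: "extend_colouring G G id S = S" for S by (simp add: extend_colouring_def)
  have law: "id.correction_law (\<lambda>_. 0)" by (simp add: id.correction_law_def ext)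
  have id_hom: "mod_hom R (C i) (C i) (\<lambda>c. c)"
    by (intro mod_hom.intro mod_hom_axioms.intro chain_module) (auto simp: module_hom_def)
  have e: "bold_chain_map R G s G s id i (e i (S, x)) = e i (S, x)" if p: "(S, x) \<in> bold_gens G i" for S x
  proof -
    have "S \<subseteq> pverts G" "x \<in> components G S" using p by (auto simp: bold_gens_def)
    moreover from this have "component_above G S x = x"
      using components_nonempty by (intro component_above_eq graph) auto
    ultimately show ?thesis
      using id.chain_map_e [OF p] id.correction_sign_eq [OF law, of S] by (simp add: k ext)
  qed
  have "mod_hom R (C i) (C i) (bold_chain_map R G s G s id i)"
    using id.chain_map_hom [of i] by (simp add: k)
  from chain_hom_ext [OF this id_hom e]
  have "bold_chain_map R G s G s id i z = z" if "z \<in> carrier (C i)" for z using that by blast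
  moreover obtain z where z: "z \<in> bold_cycles R G s i" "X = bold_boundaries R G s i +>\<^bsub>C i\<^esub> z"
    using assms by (auto simp: homology_carrier)
  ultimately show ?thesis
    using id.bold_map_coset [of z i] cycles_carrier by (simp add: k)
qed

text \<open>The sum of the correction signs of \<open>f\<close> and of \<open>g\<close> (the latter pulled back along \<open>f\<close>) satisfies
  the equations for the composite. Its value at the top is 0 because \<open>f\<close> takes the full vertex set to
  the full vertex set. By uniqueness it is the correction sign of the composite.\<close>

lemma bold_map_comp:
  assumes f: "bold_morphism R G s H t f" and g: "bold_morphism R H t J u g"
    and X: "X \<in> carrier (bold_homology R G s i)"
  shows "bold_map R G s J u (g \<circ> f) i X =
    bold_map R H t J u g (i + degree_shift G H) (bold_map R G s H t f i X)"
proof -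
  interpret f: bold_morphism R G s H t f by fact
  interpret g: bold_morphism R H t J u g by fact
  interpret gf: bold_morphism R G s J u "g \<circ> f"
    by unfold_locales (rule inj_morphism_comp [OF f.morphism g.morphism])
  note comp = extend_colouring_comp [OF f.morphism g.morphism]
  note sub = extend_colouring_subset [OF f.morphism]
  have "card (pverts G) \<le> card (pverts H)" "card (pverts H) \<le> card (pverts J)"
    using card_le_inj_morphism f.morphism g.morphism f.cod.finite_verts g.cod.finite_verts by blast+
  then have k: "i + degree_shift G J = i + degree_shift G H + degree_shift H J"
    by (simp add: degree_shift_def)
  let ?D = "g.cod.C (i + degree_shift G H + degree_shift H J)"
  interpret D: module R ?D by (rule g.cod.chain_module)
  have law: "gf.correction_law (\<lambda>S. f.\<sigma> S + g.\<sigma> (f.ext S))"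
    unfolding gf.correction_law_def
  proof (intro conjI allI impI)
    show "f.\<sigma> (pverts G) + g.\<sigma> (f.ext (pverts G)) = 0"
      by (simp add: f.correction_sign_top g.correction_sign_top extend_colouring_top [OF f.morphism])
    fix S T assume ST: "flip G S T"
    then obtain v where S: "S \<subseteq> pverts G" and v: "v \<in> pverts G - S" and T: "T = insert v S"
      by (auto simp: flip_def)
    have "flip H (f.ext S) (f.ext T)"
      using sub [OF S] extend_colouring_notin [OF f.morphism S v]
      unfolding flip_def T extend_colouring_insert by blast
    note 1 = f.correction_sign_flip [OF ST] and 2 = g.correction_sign_flip [OF this]
    have "gf.ext S = g.ext (f.ext S)" "gf.ext T = g.ext (f.ext T)"
      using S v T by (auto intro!: comp)
    then show "s S T + (f.\<sigma> T + g.\<sigma> (f.ext T)) = f.\<sigma> S + g.\<sigma> (f.ext S) + u (gf.ext S) (gf.ext T)"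
      using 1 2 by (metis add.assoc)
  qed
  have e: "gf.\<phi> i (f.dom.e i (S, x)) = (g.\<phi> (i + f.k) \<circ> f.\<phi> i) (f.dom.e i (S, x))"
    if p: "(S, x) \<in> bold_gens G i" for S x
  proof -
    interpret g_hom: mod_hom R "f.cod.C (i + f.k)" ?D "g.\<phi> (i + f.k)" by (rule g.chain_map_hom)
    from p have S: "S \<subseteq> pverts G" and x: "x \<in> components G S" by (auto simp: bold_gens_def)
    note pf = f.ext_gens [OF p]
    have "(g \<circ> f) ` x \<subseteq> g ` component_above H (f.ext S) (f ` x)"
      using f.ext_component(2) [OF p] by (auto simp: image_comp [symmetric])
    then have "component_above J (gf.ext S) ((g \<circ> f) ` x) =
        component_above J (g.ext (f.ext S)) (g ` component_above H (f.ext S) (f ` x))"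
      unfolding comp [OF S]
      using g.ext_component [OF pf] components_nonempty [OF x]
      by (intro component_above_eq g.cod.graph) blast+
    then show ?thesis
      using gf.chain_map_e [OF p] f.chain_map_e [OF p] g.chain_map_e [OF pf]
        gf.correction_sign_eq [OF law S]
      by (simp add: k comp [OF S] f.dom.sign_add D.smult_assoc1 del: add_bit_eq_xor)
  qed
  have "mod_hom R (f.dom.C i) ?D (gf.\<phi> i)" using gf.chain_map_hom [of i] by (simp add: k)
  note ext = f.dom.chain_hom_ext [OF this mod_hom_comp [OF f.chain_map_hom g.chain_map_hom] e]
  have chain: "gf.\<phi> i z = g.\<phi> (i + f.k) (f.\<phi> i z)" if "z \<in> carrier (f.dom.C i)" for z
  proof -
    have "gf.\<phi> i z = (g.\<phi> (i + f.k) \<circ> f.\<phi> i) z" using that by (rule ext [rotated])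
    also have "\<dots> = g.\<phi> (i + f.k) (f.\<phi> i z)" by (rule comp_apply)
    finally show ?thesis .
  qed
  obtain z where z: "z \<in> bold_cycles R G s i" "X = bold_boundaries R G s i +>\<^bsub>f.dom.C i\<^esub> z"
    using X by (auto simp: f.dom.homology_carrier)
  then have zC: "z \<in> carrier (f.dom.C i)" by (intro f.dom.cycles_carrier)
  then have "f.\<phi> i z \<in> carrier (f.cod.C (i + f.k))" by (rule mod_hom.f_im [OF f.chain_map_hom])
  then show ?thesis
    using zC by (simp add: z gf.bold_map_coset f.bold_map_coset g.bold_map_coset chain k)
qed

section \<open>Bold homology categorifies the connected domination polynomial at -1\<close>

lemma bold_complexI: "cring R \<Longrightarrow> fin_conn_graph G \<Longrightarrow> sign_assignment G s \<Longrightarrow> bold_complex R G s"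
  by (simp add: bold_complex_def bold_complex_axioms_def fin_conn_graph_def)

lemma bold_morphismI:
  "bold_complex R G s \<Longrightarrow> bold_complex R H t \<Longrightarrow> inj_morphism G H f \<Longrightarrow> bold_morphism R G s H t f"
  by (simp add: bold_morphism_def bold_morphism_axioms_def)

theorem theorem1p2:
  fixes R :: "('r, 'm) ring_scheme" and K :: "('k, 'n) ring_scheme"
    and G :: "'a pair_pre_digraph" and H :: "'b pair_pre_digraph" and J :: "'c pair_pre_digraph"
    and s :: "'a set \<Rightarrow> 'a set \<Rightarrow> bit" and t :: "'b set \<Rightarrow> 'b set \<Rightarrow> bit" and u :: "'c set \<Rightarrow> 'c set \<Rightarrow> bit"
    and f :: "'a \<Rightarrow> 'b" and g :: "'b \<Rightarrow> 'c" and i :: nat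
  shows
    "(cring R \<and> fin_conn_graph G \<and> sign_assignment G s \<longrightarrow>
        module R (bold_homology R G s i) \<and>
        (\<forall>X \<in> carrier (bold_homology R G s i). bold_map R G s G s id i X = X)) \<and>
     (cring R \<and> fin_conn_graph G \<and> sign_assignment G s \<and> fin_conn_graph H \<and> sign_assignment H t \<and>
        inj_morphism G H f \<longrightarrow>
        bold_map R G s H t f i \<in>
          module_hom R (bold_homology R G s i) (bold_homology R H t (i + degree_shift G H))) \<and>
     (cring R \<and> fin_conn_graph G \<and> sign_assignment G s \<and> fin_conn_graph H \<and> sign_assignment H t \<and>
        fin_conn_graph J \<and> sign_assignment J u \<and> inj_morphism G H f \<and> inj_morphism H J g \<longrightarrow>
        (\<forall>X \<in> carrier (bold_homology R G s i).
           bold_map R G s J u (g \<circ> f) i X =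
           bold_map R H t J u g (i + degree_shift G H) (bold_map R G s H t f i X))) \<and>
     (field K \<and> fin_conn_graph G \<and> sign_assignment G s \<longrightarrow>
        bold_euler K G s = poly (conn_dom_poly G) (-1))"
proof (intro conjI impI ballI; elim conjE)
  assume "cring R" "fin_conn_graph G" "sign_assignment G s"
  then interpret bold_complex R G s by (rule bold_complexI)
  show "module R (bold_homology R G s i)" by (rule homology_module)
  show "bold_map R G s G s id i X = X" if "X \<in> carrier (bold_homology R G s i)" for X
    using that by (rule bold_map_id)
next
  assume "cring R" "fin_conn_graph G" "sign_assignment G s" "fin_conn_graph H" "sign_assignment H t"
    "inj_morphism G H f"
  then interpret bold_morphism R G s H t f by (intro bold_morphismI bold_complexI)
  show "bold_map R G s H t f i \<in>
          module_hom R (bold_homology R G s i) (bold_homology R H t (i + degree_shift G H))"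
    by (rule bold_map_hom)
next
  fix X
  assume "cring R" "fin_conn_graph G" "sign_assignment G s" "fin_conn_graph H" "sign_assignment H t"
    "fin_conn_graph J" "sign_assignment J u" "inj_morphism G H f" "inj_morphism H J g"
    and X: "X \<in> carrier (bold_homology R G s i)"
  then have "bold_morphism R G s H t f" "bold_morphism R H t J u g"
    by (simp_all add: bold_morphismI bold_complexI)
  then show "bold_map R G s J u (g \<circ> f) i X =
           bold_map R H t J u g (i + degree_shift G H) (bold_map R G s H t f i X)"
    using X by (rule bold_map_comp)
next
  assume "field K" "fin_conn_graph G" "sign_assignment G s"
  then show "bold_euler K G s = poly (conn_dom_poly G) (-1)"
    by (intro bold_euler_eq) (auto simp: fin_conn_graph_def)
qed

end
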